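(* Let $G$ be an amenable group, $A$ an abelian group, and $G\overset{\alpha}{\curvearrowright}A$ a left action by group endomorphisms. Let $N$ be a normal subgroup of $G$ such that $N\subseteq\ker\alpha$, and consider the quotient action $G/N\overset{\bar\alpha_{G/N}}{\curvearrowright}A$. Then $$h_{alg}(\alpha)=\begin{cases}0&\text{if }N\text{ is infinite},\\ \dfrac{h_{alg}(\bar\alpha_{G/N})}{|N|}&\text{if }N\text{ is finite},\end{cases}\qquad\text{and}\qquad \mathrm{ent}(\alpha)=\begin{cases}0&\text{if }N\text{ is infinite},\\ \dfrac{\mathrm{ent}(\bar\alpha_{G/N})}{|N|}&\text{if }N\text{ is finite}.\end{cases}$$
   Context: Groups are considered as discrete groups; amenability is the usual notion. A right Følner net of an amenable group $G$ is a net $(F_i)_{i\in I}$ of non-empty finite subsets of $G$ with $\lim_{i\in I}|F_ig\setminus F_i|/|F_i|=0$ for every $g\in G$. A left action $G\overset{\alpha}{\curvearrowright}A$ on an abelian group $A$ assigns to each $g\in G$ an endomorphism $\alpha(g)$ of $A$ with $\alpha(gh)=\alpha(g)\circ\alpha(h)$ and $\alpha(1)=\mathrm{id}_A$; $\ker\alpha=\{g\in G:\alpha(g)=\mathrm{id}_A\}$. If $N\subseteq\ker\alpha$ is normal in $G$, the quotient action is $\bar\alpha_{G/N}(gN)=\alpha(g)$. For non-empty finite $X\subseteq A$ and non-empty finite $F\subseteq G$ put $T_F(\alpha,X)=\sum_{g\in F}\alpha(g)(X)$ (sum of subsets). Set $H_{alg}(\alpha,X)=\lim_{i\in I}\frac{\log|T_{F_i}(\alpha,X)|}{|F_i|}$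 for any right Følner net $(F_i)_{i\in I}$ of the acting group; the limit is known to exist, to be finite, and not to depend on the net. Define $h_{alg}(\alpha)=\sup\{H_{alg}(\alpha,X):X\subseteq A\text{ non-empty finite}\}$ and $\mathrm{ent}(\alpha)=\sup\{H_{alg}(\alpha,X):X\text{ a finite subgroup of }A\}$, both in $[0,\infty]$, with $\infty/|N|=\infty$ for finite $N$. *)

theory Defs
  imports
    "HOL-Algebra.Coset"
    "HOL-Algebra.FiniteProduct"
    "HOL-Library.Extended_Real"
begin

text \<open>
  Abelian groups are \<open>comm_group\<close> records, hence written multiplicatively: the sums of the
  usual additive notation appear as products.
\<close>

text \<open>Amenability of a discrete group, following von Neumann.\<close>

definition amenable :: "('g, 'm) monoid_scheme \<Rightarrow> bool" where
  "amenable G \<longleftrightarrow>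
     (\<exists>\<mu> :: 'g set \<Rightarrow> real.
        (\<forall>S. S \<subseteq> carrier G \<longrightarrow> 0 \<le> \<mu> S) \<and>
        \<mu> (carrier G) = 1 \<and>
        (\<forall>S T. S \<subseteq> carrier G \<longrightarrow> T \<subseteq> carrier G \<longrightarrow> S \<inter> T = {} \<longrightarrow> \<mu> (S \<union> T) = \<mu> S + \<mu> T) \<and>
        (\<forall>g\<in>carrier G. \<forall>S. S \<subseteq> carrier G \<longrightarrow> \<mu> (g <#\<^bsub>G\<^esub> S) = \<mu> S))"

text \<open>
  A net is an indexed family together with a proper filter on the index type; for a directed
  index set this is the filter generated by its tails.
\<close>

definition right_folner_net :: "('g, 'm) monoid_scheme \<Rightarrow> 'i filter \<Rightarrow> ('i \<Rightarrow> 'g set) \<Rightarrow> bool" where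
  "right_folner_net G I F \<longleftrightarrow>
     I \<noteq> bot \<and>
     (\<forall>\<^sub>F i in I. finite (F i) \<and> F i \<noteq> {} \<and> F i \<subseteq> carrier G) \<and>
     (\<forall>g\<in>carrier G. ((\<lambda>i. real (card ((F i #>\<^bsub>G\<^esub> g) - F i)) / real (card (F i))) \<longlongrightarrow> 0) I)"

definition left_action ::
    "('g, 'm) monoid_scheme \<Rightarrow> ('a, 'n) monoid_scheme \<Rightarrow> ('g \<Rightarrow> 'a \<Rightarrow> 'a) \<Rightarrow> bool" where
  "left_action G A \<alpha> \<longleftrightarrow>
     (\<forall>g\<in>carrier G. \<alpha> g \<in> hom A A) \<and>
     (\<forall>g\<in>carrier G. \<forall>h\<in>carrier G. \<forall>a\<in>carrier A. \<alpha> (g \<otimes>\<^bsub>G\<^esub> h) a = \<alpha> g (\<alpha> h a)) \<and>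
     (\<forall>a\<in>carrier A. \<alpha> \<one>\<^bsub>G\<^esub> a = a)"

definition action_kernel ::
    "('g, 'm) monoid_scheme \<Rightarrow> ('a, 'n) monoid_scheme \<Rightarrow> ('g \<Rightarrow> 'a \<Rightarrow> 'a) \<Rightarrow> 'g set" where
  "action_kernel G A \<alpha> = {g \<in> carrier G. \<forall>a\<in>carrier A. \<alpha> g a = a}"

text \<open>
  The argument is a coset; the lemmas below show that the choice of the representative is
  immaterial.
\<close>

definition quotient_action :: "('g \<Rightarrow> 'a \<Rightarrow> 'a) \<Rightarrow> 'g set \<Rightarrow> 'a \<Rightarrow> 'a" where
  "quotient_action \<alpha> C = \<alpha> (SOME g. g \<in> C)"

lemma quotient_action_coset:
  assumes "N \<lhd> G" "left_action G A \<alpha>" "N \<subseteq> action_kernel G A \<alpha>"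
    and "g \<in> carrier G" "a \<in> carrier A"
  shows "quotient_action \<alpha> (N #>\<^bsub>G\<^esub> g) a = \<alpha> g a"
proof -
  interpret normal N G by fact
  have "g \<in> N #>\<^bsub>G\<^esub> g"
    using assms(4) rcos_self subgroup_axioms by blast
  hence "(SOME k. k \<in> N #>\<^bsub>G\<^esub> g) \<in> N #>\<^bsub>G\<^esub> g"
    by (rule someI)
  then obtain n where n: "n \<in> N" "(SOME k. k \<in> N #>\<^bsub>G\<^esub> g) = n \<otimes>\<^bsub>G\<^esub> g"
    unfolding r_coset_def by auto
  have "\<alpha> g a \<in> carrier A"
    using assms unfolding left_action_def hom_def by auto
  moreover have "\<alpha> (n \<otimes>\<^bsub>G\<^esub> g) a = \<alpha> n (\<alpha> g a)"
    using assms n unfolding left_action_def by auto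
  ultimately show ?thesis
    using assms(3) n unfolding quotient_action_def action_kernel_def by auto
qed

lemma left_action_quotient:
  assumes N: "N \<lhd> G" and "left_action G A \<alpha>" "N \<subseteq> action_kernel G A \<alpha>"
  shows "left_action (G Mod N) A (quotient_action \<alpha>)"
proof -
  interpret normal N G by fact
  note q = quotient_action_coset[OF assms]
  have act: "\<alpha> g \<in> hom A A" if "g \<in> carrier G" for g
    using assms(2) that unfolding left_action_def by auto
  have closed: "\<alpha> g a \<in> carrier A" if "g \<in> carrier G" "a \<in> carrier A" for g a
    using act that unfolding hom_def by auto
  have car: "\<exists>g\<in>carrier G. C = N #>\<^bsub>G\<^esub> g" if "C \<in> carrier (G Mod N)" for C
    using that unfolding FactGroup_def RCOSETS_def by auto
  have "quotient_action \<alpha> C \<in> hom A A" if C: "C \<in> carrier (G Mod N)" for C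
  proof -
    obtain g where g: "g \<in> carrier G" "C = N #>\<^bsub>G\<^esub> g"
      using car[OF C] by auto
    obtain k where k: "k \<in> carrier G" "quotient_action \<alpha> C = \<alpha> k"
    proof
      have "g \<in> C"
        using g rcos_self subgroup_axioms by blast
      hence "(SOME k. k \<in> C) \<in> C"
        by (rule someI)
      thus "(SOME k. k \<in> C) \<in> carrier G"
        using g r_coset_subset_G[OF subset] by blast
    qed (simp add: quotient_action_def)
    thus ?thesis
      using act by simp
  qed
  moreover have "quotient_action \<alpha> (C \<otimes>\<^bsub>G Mod N\<^esub> D) a = quotient_action \<alpha> C (quotient_action \<alpha> D a)"
    if CD: "C \<in> carrier (G Mod N)" "D \<in> carrier (G Mod N)" "a \<in> carrier A" for C D a
  proof -
    obtain g h where gh: "g \<in> carrier G" "C = N #>\<^bsub>G\<^esub> g" "h \<in> carrier G" "D = N #>\<^bsub>G\<^esub> h"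
      using car[OF CD(1)] car[OF CD(2)] by blast
    have "C \<otimes>\<^bsub>G Mod N\<^esub> D = N #>\<^bsub>G\<^esub> (g \<otimes>\<^bsub>G\<^esub> h)"
      using gh rcos_sum by (simp add: FactGroup_def)
    thus ?thesis
      using gh q closed CD assms(2) unfolding left_action_def by auto
  qed
  moreover have "quotient_action \<alpha> \<one>\<^bsub>G Mod N\<^esub> a = a" if "a \<in> carrier A" for a
  proof -
    have "\<one>\<^bsub>G Mod N\<^esub> = N #>\<^bsub>G\<^esub> \<one>\<^bsub>G\<^esub>"
      using subset by (simp add: FactGroup_def)
    thus ?thesis
      using q[OF one_closed that] that assms(2) unfolding left_action_def by simp
  qed
  ultimately show ?thesis
    unfolding left_action_def by blast
qed

text \<open>The sum (here: product) of the subsets \<open>\<alpha> g ` X\<close>, for \<open>g \<in> F\<close>.\<close>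

definition trajectory ::
    "('a, 'n) monoid_scheme \<Rightarrow> ('g \<Rightarrow> 'a \<Rightarrow> 'a) \<Rightarrow> 'g set \<Rightarrow> 'a set \<Rightarrow> 'a set" where
  "trajectory A \<alpha> F X = {(\<Otimes>\<^bsub>A\<^esub>g\<in>F. y g) | y. \<forall>g\<in>F. y g \<in> \<alpha> g ` X}"

definition entropy_limit ::
    "('a, 'n) monoid_scheme \<Rightarrow> ('g \<Rightarrow> 'a \<Rightarrow> 'a) \<Rightarrow> 'a set \<Rightarrow> 'i filter \<Rightarrow> ('i \<Rightarrow> 'g set) \<Rightarrow> real \<Rightarrow> bool" where
  "entropy_limit A \<alpha> X I F h \<longleftrightarrow>
     ((\<lambda>i. ln (real (card (trajectory A \<alpha> (F i) X))) / real (card (F i))) \<longlongrightarrow> h) I"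

text \<open>
  The common limit along all right Foelner nets. A definition cannot quantify over index types,
  so the nets range over those indexed by the type of subsets of the group; by the lemma
  following it this covers all nets.
\<close>

definition H_alg ::
    "('g, 'm) monoid_scheme \<Rightarrow> ('a, 'n) monoid_scheme \<Rightarrow> ('g \<Rightarrow> 'a \<Rightarrow> 'a) \<Rightarrow> 'a set \<Rightarrow> real" where
  "H_alg G A \<alpha> X =
     (THE h. \<forall>(I :: 'g set filter) F. right_folner_net G I F \<longrightarrow> entropy_limit A \<alpha> X I F h)"

lemma entropy_limit_any_index:
  fixes G :: "('g, 'm) monoid_scheme" and J :: "'i filter" and E :: "'i \<Rightarrow> 'g set"
  assumes "\<forall>(I :: 'g set filter) F. right_folner_net G I F \<longrightarrow> entropy_limit A \<alpha> X I F h"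
    and "right_folner_net G J E"
  shows "entropy_limit A \<alpha> X J E h"
proof -
  have "right_folner_net G (filtermap E J) (\<lambda>S. S)"
    using assms(2) unfolding right_folner_net_def
    by (simp add: filtermap_bot_iff eventually_filtermap filterlim_filtermap)
  hence "entropy_limit A \<alpha> X (filtermap E J) (\<lambda>S. S) h"
    using assms(1) by blast
  thus ?thesis
    unfolding entropy_limit_def by (simp add: filterlim_filtermap)
qed

definition h_alg ::
    "('g, 'm) monoid_scheme \<Rightarrow> ('a, 'n) monoid_scheme \<Rightarrow> ('g \<Rightarrow> 'a \<Rightarrow> 'a) \<Rightarrow> ereal" where
  "h_alg G A \<alpha> = (SUP X \<in> {X. X \<subseteq> carrier A \<and> finite X \<and> X \<noteq> {}}. ereal (H_alg G A \<alpha> X))"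

definition ent ::
    "('g, 'm) monoid_scheme \<Rightarrow> ('a, 'n) monoid_scheme \<Rightarrow> ('g \<Rightarrow> 'a \<Rightarrow> 'a) \<Rightarrow> ereal" where
  "ent G A \<alpha> = (SUP X \<in> {X. subgroup X A \<and> finite X}. ereal (H_alg G A \<alpha> X))"

end

theory Submission
  imports Defs "HOL-Library.Nat_Bijection" "HOL-Library.Disjoint_Sets"
begin

text \<open>
  For a finite set \<open>S\<close> of functions, the entropy of the restriction of a uniform element of \<open>S\<close> to
  a set \<open>I\<close> of coordinates is a submodular function of \<open>I\<close>. Choosing for each element of a sumset
  its representation of least weight, one obtains Shearer's inequality: \<open>k\<close> times the logarithm of
  the size of a sumset over \<open>F\<close> is at most the sum of those over \<open>C\<^sub>j \<inter> F\<close>, for a cover of \<open>F\<close> by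
  sets \<open>C\<^sub>j\<close> in which each point lies in exactly \<open>k\<close> of them. Applied to the translates \<open>gK\<close>, it replaces the Ornstein-Weiss
  quasi-tilings: \<open>H(\<alpha>, X)\<close> is the infimum of \<open>ln |T\<^sub>K(\<alpha>, X)| / |K|\<close> over all finite \<open>K\<close>.
  If \<open>N\<close> is infinite, taking \<open>K \<subseteq> N\<close> makes \<open>T\<^sub>K\<close> grow only polynomially in \<open>|K|\<close>, so the infimum
  is 0. If \<open>N\<close> is finite, preimages of a Foelner net of \<open>G/N\<close> form a Foelner net of \<open>G\<close>, and
  \<open>T\<close> of the preimage of \<open>F\<close> at \<open>X\<close> is \<open>T\<^sub>F\<close> at \<open>T\<^sub>N(\<alpha>, X)\<close>; hence
  \<open>H(\<alpha>, X) = H(\<alpha>', T\<^sub>N(\<alpha>, X)) / |N|\<close> for the quotient action \<open>\<alpha>'\<close>, and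
  \<open>H(\<alpha>', X) \<le> H(\<alpha>', T\<^sub>N(\<alpha>, X))\<close>.
\<close>

section \<open>Entropy of projections\<close>

definition fiber :: "('i \<Rightarrow> 'a) set \<Rightarrow> 'i set \<Rightarrow> ('i \<Rightarrow> 'a) \<Rightarrow> ('i \<Rightarrow> 'a) set" where
  "fiber S I s = {t \<in> S. \<forall>i\<in>I. t i = s i}"

text \<open>The summand is minus the logarithm of the probability that a uniform element of
  \<open>S\<close> restricts to \<open>I\<close> as \<open>s\<close> does. The sum is thus Shannon
  entropy scaled by the size of \<open>S\<close>, which avoids any probability space.\<close>

definition proj_entropy :: "('i \<Rightarrow> 'a) set \<Rightarrow> 'i set \<Rightarrow> real" where
  "proj_entropy S I = (\<Sum>s\<in>S. ln (real (card S)) - ln (real (card (fiber S I s))))"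

lemma card_fiber_pos:
  assumes "finite S" "s \<in> S"
  shows "card (fiber S I s) > 0"
proof -
  have "s \<in> fiber S I s" "finite (fiber S I s)"
    using assms by (auto simp: fiber_def)
  thus ?thesis by (auto simp: card_gt_0_iff)
qed

text \<open>Since \<open>q\<close> determines the coordinates in \<open>I\<close>, each level set of
  \<open>q\<close> lies inside a single fiber, and its points contribute at most 1 together.\<close>

lemma sum_inverse_card_fiber_le:
  assumes "finite S" and "\<And>s t. s \<in> S \<Longrightarrow> t \<in> S \<Longrightarrow> q s = q t \<Longrightarrow> \<forall>i\<in>I. s i = t i"
  shows "(\<Sum>s\<in>S. 1 / real (card (fiber S I s))) \<le> real (card (q ` S))"
proof -
  have "(\<Sum>s\<in>S. 1 / real (card (fiber S I s)))
      = (\<Sum>v\<in>q ` S. \<Sum>s\<in>{s \<in> S. q s = v}. 1 / real (card (fiber S I s)))"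
    using assms(1) by (rule sum.image_gen)
  also have "\<dots> \<le> (\<Sum>v\<in>q ` S. 1)"
  proof (rule sum_mono)
    fix v assume v: "v \<in> q ` S"
    let ?Q = "{s \<in> S. q s = v}"
    have Q: "finite ?Q" "card ?Q > 0"
      using v assms(1) by (force simp: card_gt_0_iff)+
    have "(\<Sum>s\<in>?Q. 1 / real (card (fiber S I s))) \<le> (\<Sum>s\<in>?Q. 1 / real (card ?Q))"
    proof (rule sum_mono)
      fix s assume s: "s \<in> ?Q"
      have "?Q \<subseteq> fiber S I s"
        using s assms(2) by (auto simp: fiber_def)
      hence "card ?Q \<le> card (fiber S I s)"
        using assms(1) by (intro card_mono) (auto simp: fiber_def)
      thus "1 / real (card (fiber S I s)) \<le> 1 / real (card ?Q)"
        using Q by (intro divide_left_mono) auto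
    qed
    also have "\<dots> = 1"
    proof -
      have "real (card ?Q) \<noteq> 0" using Q(2) by linarith
      thus ?thesis unfolding sum_constant times_divide_eq_right mult_1_right by (rule divide_self)
    qed
    finally show "(\<Sum>s\<in>?Q. 1 / real (card (fiber S I s))) \<le> 1" .
  qed
  finally show ?thesis by simp
qed

text \<open>Entropy is at most the logarithm of the number of values. Instead of Jensen's
  inequality, ln x \<le> x - 1 is applied to each term and the previous lemma bounds the sum. The
  map \<open>q\<close> only has to determine the restriction to \<open>I\<close>; later it is the
  partial product over \<open>I\<close>.\<close>

lemma proj_entropy_le:
  assumes "finite S" "S \<noteq> {}"
    and "\<And>s t. s \<in> S \<Longrightarrow> t \<in> S \<Longrightarrow> q s = q t \<Longrightarrow> \<forall>i\<in>I. s i = t i"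
  shows "proj_entropy S I \<le> real (card S) * ln (real (card (q ` S)))"
proof -
  let ?n = "real (card S)" and ?m = "real (card (q ` S))"
  have pos: "?n > 0" "?m > 0"
    using assms by (auto simp: card_gt_0_iff)
  have "proj_entropy S I - ?n * ln ?m
      = (\<Sum>s\<in>S. ln ?n - ln (real (card (fiber S I s))) - ln ?m)"
    by (simp add: proj_entropy_def sum_subtractf)
  also have "\<dots> \<le> (\<Sum>s\<in>S. ?n / ?m * (1 / real (card (fiber S I s))) - 1)"
  proof (rule sum_mono)
    fix s assume "s \<in> S"
    hence c: "real (card (fiber S I s)) > 0"
      using card_fiber_pos assms(1) by fastforce
    have "ln ?n - ln (real (card (fiber S I s))) - ln ?m
        = ln (?n / ?m * (1 / real (card (fiber S I s))))"
      using pos c by (simp add: ln_div ln_mult)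
    also have "\<dots> \<le> ?n / ?m * (1 / real (card (fiber S I s))) - 1"
      using pos c by (intro ln_le_minus_one) simp
    finally show "ln ?n - ln (real (card (fiber S I s))) - ln ?m
        \<le> ?n / ?m * (1 / real (card (fiber S I s))) - 1" .
  qed
  also have "\<dots> = ?n / ?m * (\<Sum>s\<in>S. 1 / real (card (fiber S I s))) - ?n"
    by (simp only: sum_subtractf sum_distrib_left) simp
  also have "\<dots> \<le> ?n / ?m * ?m - ?n"
    by (intro diff_right_mono mult_left_mono sum_inverse_card_fiber_le assms) (use pos in simp_all)
  also have "\<dots> = 0" using pos by simp
  finally show ?thesis by simp
qed

lemma proj_entropy_empty: "proj_entropy S {} = 0"
  by (simp add: proj_entropy_def fiber_def)

lemma proj_entropy_separating:
  assumes "\<And>s t. s \<in> S \<Longrightarrow> t \<in> S \<Longrightarrow> \<forall>i\<in>I. s i = t i \<Longrightarrow> s = t"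
  shows "proj_entropy S I = real (card S) * ln (real (card S))"
proof -
  have "fiber S I s = {s}" if "s \<in> S" for s
    using assms that by (auto simp: fiber_def)
  thus ?thesis by (simp add: proj_entropy_def)
qed

section \<open>Submodularity and Shearer's inequality\<close>

lemma sum_fiber_eq_if:
  assumes "finite S"
  shows "(\<Sum>t\<in>fiber S I s. g t) = (\<Sum>t\<in>S. if \<forall>i\<in>I. t i = s i then g t else 0)"
  unfolding fiber_def using assms by (rule sum.inter_filter)

text \<open>The numerators count pairs (t, u) where t agrees with s on \<open>I\<close> and u agrees
  with s on \<open>J\<close>. After exchanging sums, the s belonging to a fixed pair form one fiber
  over the union, so they cancel the first denominator. They exist only if u agrees with t on the
  intersection, and summing over those u cancels the second.\<close>

lemma sum_fiber_ratio_le: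
  assumes "finite S"
  shows "(\<Sum>s\<in>S. real (card (fiber S I s)) * real (card (fiber S J s))
           / (real (card (fiber S (I \<union> J) s)) * real (card (fiber S (I \<inter> J) s))))
         \<le> real (card S)"
proof -
  let ?c = "\<lambda>I s. real (card (fiber S I s))"
  let ?M = "\<lambda>t u. {s \<in> S. (\<forall>i\<in>I. t i = s i) \<and> (\<forall>i\<in>J. u i = s i)}"
  have fin: "finite (fiber S I s)" for I s
    using assms by (auto simp: fiber_def)
  have "(\<Sum>s\<in>S. ?c I s * ?c J s / (?c (I \<union> J) s * ?c (I \<inter> J) s))
      = (\<Sum>s\<in>S. \<Sum>t\<in>fiber S I s. \<Sum>u\<in>fiber S J s. 1 / (?c (I \<union> J) s * ?c (I \<inter> J) s))"
    by simp
  also have "\<dots> = (\<Sum>s\<in>S. \<Sum>t\<in>S. \<Sum>u\<in>S. if s \<in> ?M t u then 1 / (?c (I \<union> J) s * ?c (I \<inter> J) s) else 0)"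
  proof (rule sum.cong[OF refl])
    fix s assume s: "s \<in> S"
    show "(\<Sum>t\<in>fiber S I s. \<Sum>u\<in>fiber S J s. 1 / (?c (I \<union> J) s * ?c (I \<inter> J) s))
        = (\<Sum>t\<in>S. \<Sum>u\<in>S. if s \<in> ?M t u then 1 / (?c (I \<union> J) s * ?c (I \<inter> J) s) else 0)"
      unfolding sum_fiber_eq_if[OF assms]
    proof (rule sum.cong[OF refl])
      fix t assume "t \<in> S"
      show "(if \<forall>i\<in>I. t i = s i
          then \<Sum>u\<in>S. if \<forall>i\<in>J. u i = s i then 1 / (?c (I \<union> J) s * ?c (I \<inter> J) s) else 0 else 0)
        = (\<Sum>u\<in>S. if s \<in> ?M t u then 1 / (?c (I \<union> J) s * ?c (I \<inter> J) s) else 0)"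
      proof (cases "\<forall>i\<in>I. t i = s i")
        case True
        thus ?thesis using s by simp
      next
        case False
        hence "\<not> s \<in> ?M t u" for u
          by blast
        thus ?thesis
          by (simp only: False if_False sum.neutral_const)
      qed
    qed
  qed
  also have "\<dots> = (\<Sum>t\<in>S. \<Sum>u\<in>S. \<Sum>s\<in>S. if s \<in> ?M t u then 1 / (?c (I \<union> J) s * ?c (I \<inter> J) s) else 0)"
    by (rule trans[OF sum.swap], rule sum.cong[OF refl], rule sum.swap)
  also have "\<dots> \<le> (\<Sum>t\<in>S. \<Sum>u\<in>S. if u \<in> fiber S (I \<inter> J) t then 1 / ?c (I \<inter> J) t else 0)"
  proof (intro sum_mono)
    fix t u assume tu: "t \<in> S" "u \<in> S"
    have "(\<Sum>s\<in>S. if s \<in> ?M t u then 1 / (?c (I \<union> J) s * ?c (I \<inter> J) s) else 0)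
        = (\<Sum>s\<in>S \<inter> ?M t u. 1 / (?c (I \<union> J) s * ?c (I \<inter> J) s))"
      by (rule sum.inter_restrict[OF assms, symmetric])
    also have "S \<inter> ?M t u = ?M t u"
      by blast
    also have "(\<Sum>s\<in>?M t u. 1 / (?c (I \<union> J) s * ?c (I \<inter> J) s))
        = (\<Sum>s\<in>?M t u. 1 / (real (card (?M t u)) * ?c (I \<inter> J) t))"
    proof (rule sum.cong[OF refl])
      fix s assume s: "s \<in> ?M t u"
      have "fiber S (I \<union> J) s = ?M t u" "fiber S (I \<inter> J) s = fiber S (I \<inter> J) t"
        using s by (auto simp: fiber_def)
      thus "1 / (?c (I \<union> J) s * ?c (I \<inter> J) s) = 1 / (real (card (?M t u)) * ?c (I \<inter> J) t)"
        by simp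
    qed
    also have "\<dots> \<le> (if u \<in> fiber S (I \<inter> J) t then 1 / ?c (I \<inter> J) t else 0)"
    proof (cases "?M t u = {}")
      case True
      show ?thesis
        unfolding True by simp
    next
      case False
      hence "u \<in> fiber S (I \<inter> J) t"
        using tu by (auto simp: fiber_def)
      moreover have "real m * (1 / (real m * x)) \<le> 1 / x" if "x \<ge> 0" for m x
        using that by (cases "m = 0") auto
      ultimately show ?thesis
        by (simp only: if_True sum_constant of_nat_0_le_iff)
    qed
    finally show "(\<Sum>s\<in>S. if s \<in> ?M t u then 1 / (?c (I \<union> J) s * ?c (I \<inter> J) s) else 0)
        \<le> (if u \<in> fiber S (I \<inter> J) t then 1 / ?c (I \<inter> J) t else 0)" .
  qed
  also have "\<dots> = (\<Sum>t\<in>S. 1)"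
  proof (rule sum.cong[OF refl])
    fix t assume t: "t \<in> S"
    have "(\<Sum>u\<in>S. if u \<in> fiber S (I \<inter> J) t then 1 / ?c (I \<inter> J) t else 0)
        = (\<Sum>u\<in>fiber S (I \<inter> J) t. 1 / ?c (I \<inter> J) t)"
      unfolding sum_fiber_eq_if[OF assms] by (rule sum.cong) (simp_all add: fiber_def)
    thus "(\<Sum>u\<in>S. if u \<in> fiber S (I \<inter> J) t then 1 / ?c (I \<inter> J) t else 0) = 1"
      using card_fiber_pos[OF assms t, of "I \<inter> J"] by simp
  qed
  finally show ?thesis by simp
qed

text \<open>This is strong subadditivity of entropy: ln x \<le> x - 1 turns the difference of the
  two sides into the sum of ratios just bounded, minus the size of \<open>S\<close>.\<close>

lemma proj_entropy_submodular:
  assumes "finite S"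
  shows "proj_entropy S (I \<union> J) + proj_entropy S (I \<inter> J) \<le> proj_entropy S I + proj_entropy S J"
proof -
  let ?c = "\<lambda>I s. real (card (fiber S I s))"
  have "proj_entropy S (I \<union> J) + proj_entropy S (I \<inter> J) - proj_entropy S I - proj_entropy S J
      = (\<Sum>s\<in>S. ln (?c I s) + ln (?c J s) - ln (?c (I \<union> J) s) - ln (?c (I \<inter> J) s))"
    by (simp add: proj_entropy_def sum_subtractf sum.distrib)
  also have "\<dots> \<le> (\<Sum>s\<in>S. ?c I s * ?c J s / (?c (I \<union> J) s * ?c (I \<inter> J) s) - 1)"
  proof (rule sum_mono)
    fix s assume "s \<in> S"
    hence c: "?c I s > 0" for I
      using card_fiber_pos assms by fastforce
    have "ln (?c I s) + ln (?c J s) - ln (?c (I \<union> J) s) - ln (?c (I \<inter> J) s)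
        = ln (?c I s * ?c J s / (?c (I \<union> J) s * ?c (I \<inter> J) s))"
      using c[of I] c[of J] c[of "I \<union> J"] c[of "I \<inter> J"] by (simp add: ln_div ln_mult)
    also have "\<dots> \<le> ?c I s * ?c J s / (?c (I \<union> J) s * ?c (I \<inter> J) s) - 1"
      using c[of I] c[of J] c[of "I \<union> J"] c[of "I \<inter> J"] by (intro ln_le_minus_one) simp
    finally show "ln (?c I s) + ln (?c J s) - ln (?c (I \<union> J) s) - ln (?c (I \<inter> J) s)
        \<le> ?c I s * ?c J s / (?c (I \<union> J) s * ?c (I \<inter> J) s) - 1" .
  qed
  also have "\<dots> \<le> 0"
    using sum_fiber_ratio_le[OF assms, of I J] by (simp add: sum_subtractf)
  finally show ?thesis by simp
qed

text \<open>By diminishing returns, adding a point x to \<open>F\<close> raises \<open>H\<close> on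
  each trace \<open>C j \<inter> F\<close> with x in \<open>C j\<close> by at least the increase of
  \<open>H F\<close>. This happens for exactly \<open>k\<close> indices. Monotonicity of
  \<open>H\<close> is not assumed, so the increase may be negative and the multiplicity has to be
  exact.\<close>

lemma submodular_cover:
  fixes H :: "'i set \<Rightarrow> real"
  assumes sub: "\<And>I J. H (I \<union> J) + H (I \<inter> J) \<le> H I + H J" and "H {} = 0"
    and "finite J" "finite F" "\<And>x. x \<in> F \<Longrightarrow> card {j \<in> J. x \<in> C j} = k"
  shows "real k * H F \<le> (\<Sum>j\<in>J. H (C j \<inter> F))"
  using assms(4,5)
proof (induction F)
  case empty
  thus ?case using \<open>H {} = 0\<close> by simp
next
  case (insert x F)
  have step: "H (C j \<inter> F) + (if x \<in> C j then H (insert x F) - H F else 0) \<le> H (C j \<inter> insert x F)" for j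
  proof (cases "x \<in> C j")
    case True
    have "F \<union> insert x (C j \<inter> F) = insert x F" "F \<inter> insert x (C j \<inter> F) = C j \<inter> F"
      using insert.hyps by auto
    hence "H (insert x F) + H (C j \<inter> F) \<le> H F + H (insert x (C j \<inter> F))"
      using sub[of F "insert x (C j \<inter> F)"] by simp
    thus ?thesis using True by simp
  qed simp
  have "real k * H (insert x F) = real k * H F + real (card {j \<in> J. x \<in> C j}) * (H (insert x F) - H F)"
    using insert.prems by (simp add: algebra_simps)
  also have "\<dots> \<le> (\<Sum>j\<in>J. H (C j \<inter> F)) + (\<Sum>j\<in>{j \<in> J. x \<in> C j}. H (insert x F) - H F)"
    using insert by simp
  also have "\<dots> = (\<Sum>j\<in>J. H (C j \<inter> F) + (if x \<in> C j then H (insert x F) - H F else 0))"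
    unfolding sum.distrib by (subst sum.inter_filter[OF \<open>finite J\<close>]) simp
  also have "\<dots> \<le> (\<Sum>j\<in>J. H (C j \<inter> insert x F))"
    by (intro sum_mono step)
  finally show ?case .
qed

section \<open>Cardinalities of product sets\<close>

text \<open>A trajectory with an arbitrary family in place of the images of one set, so that the
  factors may again be product sets, as when cosets serve as indices.\<close>

definition set_prod :: "('a, 'n) monoid_scheme \<Rightarrow> ('i \<Rightarrow> 'a set) \<Rightarrow> 'i set \<Rightarrow> 'a set" where
  "set_prod A B I = {(\<Otimes>\<^bsub>A\<^esub>i\<in>I. y i) | y. \<forall>i\<in>I. y i \<in> B i}"

lemma trajectory_eq_set_prod: "trajectory A \<alpha> F X = set_prod A (\<lambda>g. \<alpha> g ` X) F"
  by (simp add: trajectory_def set_prod_def)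

context comm_monoid
begin

lemma set_prod_eq_image_PiE:
  assumes "\<And>i. i \<in> I \<Longrightarrow> B i \<subseteq> carrier G"
  shows "set_prod G B I = (\<lambda>y. finprod G y I) ` Pi\<^sub>E I B"
proof -
  have "\<exists>z\<in>Pi\<^sub>E I B. finprod G y I = finprod G z I" if y: "\<forall>i\<in>I. y i \<in> B i" for y
  proof
    show "restrict y I \<in> Pi\<^sub>E I B"
      using y by auto
    show "finprod G y I = finprod G (restrict y I) I"
      by (rule finprod_cong') (use y assms in auto)
  qed
  thus ?thesis
    by (fastforce simp: set_prod_def)
qed

lemma finite_set_prod:
  assumes "finite I" "\<And>i. i \<in> I \<Longrightarrow> B i \<subseteq> carrier G" "\<And>i. i \<in> I \<Longrightarrow> finite (B i)"
  shows "finite (set_prod G B I)"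
  by (subst set_prod_eq_image_PiE) (use assms in \<open>auto intro!: finite_PiE\<close>)

lemma set_prod_nonempty:
  assumes "\<And>i. i \<in> I \<Longrightarrow> B i \<noteq> {}"
  shows "set_prod G B I \<noteq> {}"
proof -
  have "\<forall>i\<in>I. (SOME b. b \<in> B i) \<in> B i"
    using assms by (simp add: some_in_eq)
  thus ?thesis
    by (auto simp: set_prod_def)
qed

lemma set_prod_subset_carrier:
  assumes "\<And>i. i \<in> I \<Longrightarrow> B i \<subseteq> carrier G"
  shows "set_prod G B I \<subseteq> carrier G"
  using assms by (auto simp: set_prod_def intro!: finprod_closed)

end

text \<open>Multiplying by one fixed choice of factors over \<open>J - I\<close> maps the smaller
  product set into the larger one, injectively by cancellation.\<close>

lemma (in comm_group) card_set_prod_mono: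
  assumes "I \<subseteq> J" "finite J" and B: "\<And>i. i \<in> J \<Longrightarrow> B i \<subseteq> carrier G \<and> finite (B i) \<and> B i \<noteq> {}"
  shows "card (set_prod G B I) \<le> card (set_prod G B J)"
proof -
  define z where "z = (\<lambda>i. SOME b. b \<in> B i)"
  have z: "z i \<in> B i" if "i \<in> J" for i
    using B[OF that] by (simp add: z_def some_in_eq)
  let ?c = "finprod G z (J - I)"
  have c: "?c \<in> carrier G"
    using z B by (intro finprod_closed) blast
  have fin: "finite I" "finite (J - I)"
    using assms by (auto intro: finite_subset)
  have "(\<lambda>v. v \<otimes> ?c) ` set_prod G B I \<subseteq> set_prod G B J"
  proof clarify
    fix v assume "v \<in> set_prod G B I"
    then obtain y where y: "\<forall>i\<in>I. y i \<in> B i" "v = finprod G y I"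
      by (auto simp: set_prod_def)
    define u where "u i = (if i \<in> I then y i else z i)" for i
    have u: "\<forall>i\<in>J. u i \<in> B i"
      using y z by (auto simp: u_def)
    have "finprod G u (I \<union> (J - I)) = finprod G u I \<otimes> finprod G u (J - I)"
      by (rule finprod_Un_disjoint) (use fin u B assms(1) in blast)+
    moreover have "finprod G u I = finprod G y I" "finprod G u (J - I) = ?c"
      by (rule finprod_cong'; use y z B assms(1) in \<open>force simp: u_def\<close>)+
    moreover have "I \<union> (J - I) = J"
      using assms(1) by blast
    ultimately have "v \<otimes> ?c = finprod G u J"
      using y by simp
    thus "v \<otimes> ?c \<in> set_prod G B J"
      using u by (auto simp: set_prod_def)
  qed
  moreover have "inj_on (\<lambda>v. v \<otimes> ?c) (set_prod G B I)"
  proof (rule inj_onI)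
    fix v w assume "v \<in> set_prod G B I" "w \<in> set_prod G B I" "v \<otimes> ?c = w \<otimes> ?c"
    moreover have "set_prod G B I \<subseteq> carrier G"
      using B assms(1) by (intro set_prod_subset_carrier) blast
    ultimately show "v = w"
      using c right_cancel by blast
  qed
  moreover have "finite (set_prod G B J)"
    using assms by (intro finite_set_prod) auto
  ultimately show ?thesis
    using card_inj_on_le by blast
qed

text \<open>Number all pairs (i, b) injectively and give b at i the weight 2 to that number. The
  weight of a choice over \<open>I\<close> is then the binary code of its graph, so it determines
  the choice on every subset \<open>I\<close>, not only on all of \<open>F\<close>.\<close>

lemma injective_additive_weight:
  assumes "finite F" "\<And>i. i \<in> F \<Longrightarrow> finite (B i)"
  shows "\<exists>w :: 'i \<Rightarrow> 'a \<Rightarrow> nat. \<forall>I y z. I \<subseteq> F \<longrightarrow> (\<forall>i\<in>I. y i \<in> B i) \<longrightarrow> (\<forall>i\<in>I. z i \<in> B i) \<longrightarrow>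
    (\<Sum>i\<in>I. w i (y i)) = (\<Sum>i\<in>I. w i (z i)) \<longrightarrow> (\<forall>i\<in>I. y i = z i)"
proof -
  obtain e :: "'i \<times> 'a \<Rightarrow> nat" and n where e: "inj_on e (Sigma F B)"
    using finite_imp_inj_to_nat_seg[of "Sigma F B"] assms by auto
  show ?thesis
  proof (intro exI allI impI)
    fix I y z
    assume I: "I \<subseteq> F" and y: "\<forall>i\<in>I. y i \<in> B i" and z: "\<forall>i\<in>I. z i \<in> B i"
      and eq: "(\<Sum>i\<in>I. 2 ^ e (i, y i)) = (\<Sum>i\<in>I. (2 :: nat) ^ e (i, z i))"
    have fin: "finite I"
      using I assms(1) by (rule finite_subset)
    have code: "(\<Sum>i\<in>I. 2 ^ e (i, u i)) = set_encode (e ` (\<lambda>i. (i, u i)) ` I)"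
      if "\<forall>i\<in>I. u i \<in> B i" for u
    proof -
      have "inj_on (\<lambda>i. e (i, u i)) I"
      proof (rule inj_onI)
        fix i j assume ij: "i \<in> I" "j \<in> I" "e (i, u i) = e (j, u j)"
        hence "(i, u i) = (j, u j)"
          using that I by (intro inj_onD[OF e]) auto
        thus "i = j" by simp
      qed
      thus ?thesis
        by (simp add: set_encode_def image_image sum.reindex)
    qed
    have "e ` (\<lambda>i. (i, y i)) ` I = e ` (\<lambda>i. (i, z i)) ` I"
      using eq fin unfolding code[OF y] code[OF z] by (simp add: set_encode_eq)
    hence "(\<lambda>i. (i, y i)) ` I = (\<lambda>i. (i, z i)) ` I"
      by (rule inj_on_image_eq_iff[OF e, THEN iffD1, rotated -1]) (use I y z in auto)
    thus "\<forall>i\<in>I. y i = z i"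
      by auto
  qed
qed

text \<open>
  The section picks representations of least weight. Two of them with the same partial product over
  \<open>I\<close> have the same weight on \<open>I\<close>, as otherwise exchanging that part would lower the weight of one.
\<close>

lemma (in comm_group) compressed_section:
  fixes B :: "'i \<Rightarrow> 'a set"
  assumes "finite F" and B: "\<And>i. i \<in> F \<Longrightarrow> B i \<subseteq> carrier G \<and> finite (B i)"
  obtains S where "S \<subseteq> Pi\<^sub>E F B" "bij_betw (\<lambda>s. finprod G s F) S (set_prod G B F)"
    "\<And>I s t. \<lbrakk>I \<subseteq> F; s \<in> S; t \<in> S; finprod G s I = finprod G t I\<rbrakk> \<Longrightarrow> \<forall>i\<in>I. s i = t i"
proof -
  have BC: "\<And>i. i \<in> F \<Longrightarrow> B i \<subseteq> carrier G"
    using B by blast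
  have finB: "\<And>i. i \<in> F \<Longrightarrow> finite (B i)"
    using B by blast
  obtain w :: "'i \<Rightarrow> 'a \<Rightarrow> nat" where w:
    "\<forall>I y z. I \<subseteq> F \<longrightarrow> (\<forall>i\<in>I. y i \<in> B i) \<longrightarrow> (\<forall>i\<in>I. z i \<in> B i) \<longrightarrow>
      (\<Sum>i\<in>I. w i (y i)) = (\<Sum>i\<in>I. w i (z i)) \<longrightarrow> (\<forall>i\<in>I. y i = z i)"
    using injective_additive_weight[OF assms(1) finB] by (rule exE)
  have eq: "set_prod G B F = (\<lambda>y. finprod G y F) ` Pi\<^sub>E F B"
    using BC by (rule set_prod_eq_image_PiE)
  define W where "W I y = (\<Sum>i\<in>I. w i (y i))" for I y
  define r where "r v = arg_min (W F) (\<lambda>y. y \<in> Pi\<^sub>E F B \<and> finprod G y F = v)" for v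
  have r: "r v \<in> Pi\<^sub>E F B \<and> finprod G (r v) F = v"
    and r_min: "\<And>y. y \<in> Pi\<^sub>E F B \<Longrightarrow> finprod G y F = v \<Longrightarrow> W F (r v) \<le> W F y"
    if v: "v \<in> set_prod G B F" for v
  proof -
    obtain y where "y \<in> Pi\<^sub>E F B \<and> finprod G y F = v"
      using v unfolding eq by blast
    thus "r v \<in> Pi\<^sub>E F B \<and> finprod G (r v) F = v"
      unfolding r_def by (rule arg_min_natI[where P = "\<lambda>y. y \<in> Pi\<^sub>E F B \<and> finprod G y F = v"])
    show "W F (r v) \<le> W F z" if "z \<in> Pi\<^sub>E F B" "finprod G z F = v" for z
      unfolding r_def using that
      by (intro arg_min_nat_le[where P = "\<lambda>y. y \<in> Pi\<^sub>E F B \<and> finprod G y F = v"]) simp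
  qed
  have less: "W I (r v) \<le> W I (r u)"
    if I: "I \<subseteq> F" and v: "v \<in> set_prod G B F" and u: "u \<in> set_prod G B F"
      and eq: "finprod G (r v) I = finprod G (r u) I" for I v u
  proof -
    let ?s = "r v" and ?t = "r u"
    have fin: "finite I" "finite (F - I)" and F: "I \<union> (F - I) = F"
      using I assms(1) by (auto intro: finite_subset)
    \<comment> \<open>The competitor for \<open>r v\<close>: its part over \<open>I\<close> is
      replaced by that of \<open>r u\<close>. Equal partial products keep the total product
      unchanged, so minimality applies to it.\<close>
    define z where "z i = (if i \<in> I then ?t i else ?s i)" for i
    have st: "?s \<in> Pi\<^sub>E F B" "?t \<in> Pi\<^sub>E F B"
      using r u v by auto
    have z: "z \<in> Pi\<^sub>E F B"
      using st I by (auto simp: z_def PiE_def Pi_def extensional_def)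
    have split: "finprod G y F = finprod G y I \<otimes> finprod G y (F - I)"
      if "y \<in> Pi\<^sub>E F B" for y
      using that B I fin by (subst F[symmetric], intro finprod_Un_disjoint) (auto simp: PiE_def Pi_def)
    have "finprod G z I = finprod G ?t I" "finprod G z (F - I) = finprod G ?s (F - I)"
      by (rule finprod_cong'; use st I B in \<open>force simp: z_def PiE_def Pi_def\<close>)+
    hence "finprod G z F = finprod G ?s F"
      using split[OF z] split[OF st(1)] eq by simp
    hence "W F ?s \<le> W F z"
      using r[OF v] r_min[OF v z] by simp
    moreover have "W F y = W I y + W (F - I) y" for y
      using fin unfolding W_def by (subst F[symmetric], intro sum.union_disjoint) auto
    moreover have "W I z = W I ?t" "W (F - I) z = W (F - I) ?s"
      unfolding W_def by (rule sum.cong; simp add: z_def)+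
    ultimately show ?thesis by simp
  qed
  show thesis
  proof
    show "r ` set_prod G B F \<subseteq> Pi\<^sub>E F B"
      using r by auto
    have "inj_on (\<lambda>s. finprod G s F) (r ` set_prod G B F)"
      using r by (auto intro!: inj_onI)
    moreover have "(\<lambda>s. finprod G s F) ` r ` set_prod G B F = set_prod G B F"
      using r by (force simp: image_image)
    ultimately show "bij_betw (\<lambda>s. finprod G s F) (r ` set_prod G B F) (set_prod G B F)"
      by (simp add: bij_betw_def)
    fix I s t
    assume I: "I \<subseteq> F" and s: "s \<in> r ` set_prod G B F" and t: "t \<in> r ` set_prod G B F"
      and eq: "finprod G s I = finprod G t I"
    have in_B: "\<forall>i\<in>I. y i \<in> B i" if "y \<in> r ` set_prod G B F" for y
      using that r I by (fastforce simp: PiE_def Pi_def)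
    \<comment> \<open>The inequality \<open>less\<close> is used in both directions; the injectivity
      of the weight on \<open>I\<close> then gives equal coordinates.\<close>
    have "W I s = W I t"
      using s t less[OF I] eq by (metis (no_types, lifting) imageE le_antisym)
    thus "\<forall>i\<in>I. s i = t i"
      using w[THEN spec[of _ I], THEN spec[of _ s], THEN spec[of _ t]] I in_B[OF s] in_B[OF t]
      unfolding W_def by blast
  qed
qed

text \<open>For a compressed section \<open>S\<close>, the entropy on \<open>F\<close> is maximal
  since \<open>F\<close> separates the points of \<open>S\<close>. On each part of \<open>F\<close>
  it is bounded by the logarithm of the partial product set, because partial products determine
  coordinates there. Shearer's inequality compares the two, and the common factor
  \<open>card S\<close> cancels.\<close>

lemma (in comm_group) set_prod_cover:
  assumes "finite F" and B: "\<And>i. i \<in> F \<Longrightarrow> B i \<subseteq> carrier G \<and> finite (B i) \<and> B i \<noteq> {}"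
    and "finite J" and cover: "\<And>x. x \<in> F \<Longrightarrow> card {j \<in> J. x \<in> C j} = k"
  shows "real k * ln (real (card (set_prod G B F))) \<le> (\<Sum>j\<in>J. ln (real (card (set_prod G B (C j \<inter> F)))))"
proof -
  obtain S where S: "S \<subseteq> Pi\<^sub>E F B" "bij_betw (\<lambda>s. finprod G s F) S (set_prod G B F)"
    and sep: "\<And>I s t. \<lbrakk>I \<subseteq> F; s \<in> S; t \<in> S; finprod G s I = finprod G t I\<rbrakk> \<Longrightarrow> \<forall>i\<in>I. s i = t i"
    using compressed_section[OF assms(1), of B] B by blast
  have fin: "finite S"
    using S(1) assms(1) B by (meson finite_PiE finite_subset)
  have card: "card S = card (set_prod G B F)"
    using S(2) by (rule bij_betw_same_card)
  moreover have "set_prod G B F \<noteq> {}"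
    using B by (intro set_prod_nonempty) auto
  moreover have "finite (set_prod G B F)"
    using assms(1) B by (intro finite_set_prod) auto
  ultimately have pos: "card S > 0"
    by (simp add: card_gt_0_iff)
  hence ne: "S \<noteq> {}" by auto
  have full: "proj_entropy S F = real (card S) * ln (real (card S))"
  proof (rule proj_entropy_separating)
    fix s t assume "s \<in> S" "t \<in> S" "\<forall>i\<in>F. s i = t i"
    thus "s = t"
      using S(1) by (intro PiE_ext[of s F B t]) auto
  qed
  have part: "proj_entropy S I \<le> real (card S) * ln (real (card (set_prod G B I)))"
    if I: "I \<subseteq> F" for I
  proof -
    have "proj_entropy S I \<le> real (card S) * ln (real (card ((\<lambda>s. finprod G s I) ` S)))"
      using fin ne sep[OF I] by (rule proj_entropy_le)
    moreover have "(\<lambda>s. finprod G s I) ` S \<subseteq> set_prod G B I"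
      using S(1) I by (fastforce simp: set_prod_def)
    hence "card ((\<lambda>s. finprod G s I) ` S) \<le> card (set_prod G B I)"
      using assms(1) B I by (intro card_mono finite_set_prod) (auto intro: finite_subset)
    moreover have "card ((\<lambda>s. finprod G s I) ` S) > 0"
      using fin ne by (simp add: card_gt_0_iff)
    ultimately show ?thesis
      by (smt (verit) ln_le_cancel_iff mult_left_mono of_nat_0_le_iff of_nat_0_less_iff of_nat_mono)
  qed
  have "real (card S) * (real k * ln (real (card S))) = real k * proj_entropy S F"
    by (simp add: full)
  also have "\<dots> \<le> (\<Sum>j\<in>J. proj_entropy S (C j \<inter> F))"
    using proj_entropy_submodular[OF fin] proj_entropy_empty assms(3,1) cover
    by (rule submodular_cover)
  also have "\<dots> \<le> (\<Sum>j\<in>J. real (card S) * ln (real (card (set_prod G B (C j \<inter> F)))))"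
    by (intro sum_mono part) auto
  finally show ?thesis
    using pos by (simp add: card sum_distrib_left[symmetric])
qed

section \<open>Foelner nets from invariant means\<close>

text \<open>
  Rado's argument: a minimal subrelation satisfying Hall's condition is the graph of a function. Zorn's
  lemma is applied to the set of removed pairs.
\<close>

theorem hall_locally_finite:
  fixes A :: "'i \<Rightarrow> 'b set"
  assumes fin: "\<And>i. i \<in> I \<Longrightarrow> finite (A i)"
    and hall: "\<And>J. J \<subseteq> I \<Longrightarrow> finite J \<Longrightarrow> card J \<le> card (\<Union>i\<in>J. A i)"
  obtains \<phi> where "inj_on \<phi> I" "\<And>i. i \<in> I \<Longrightarrow> \<phi> i \<in> A i"
proof -
  define S where "S = Sigma I A"
  define \<D> where "\<D> = {D. D \<subseteq> S \<and> (\<forall>J. J \<subseteq> I \<longrightarrow> finite J \<longrightarrow> card J \<le> card ((S - D) `` J))}"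
  have fin_img: "finite (S `` J)" if "J \<subseteq> I" "finite J" for J
  proof -
    have "S `` J = (\<Union>i\<in>J. A i)"
      using that by (auto simp: S_def)
    thus ?thesis
      using that fin by auto
  qed
  have "\<exists>M\<in>\<D>. \<forall>X\<in>\<D>. M \<subseteq> X \<longrightarrow> X = M"
  proof (rule subset_Zorn')
    fix C assume C: "subset.chain \<D> C"
    hence sub: "C \<subseteq> \<D>"
      by (auto simp: subset.chain_def)
    have "card J \<le> card ((S - \<Union>C) `` J)" if J: "J \<subseteq> I" "finite J" for J
    proof (cases "C = {}")
      case True
      have "S `` J = (\<Union>i\<in>J. A i)"
        using J by (auto simp: S_def)
      thus ?thesis
        using hall[OF J] True by simp
    next
      case False
      \<comment> \<open>Only finitely many pairs lie over \<open>J\<close>, so a single member of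
        the chain already removes every pair over \<open>J\<close> that the union removes.\<close>
      have "finite (Sigma J A \<inter> \<Union>C)"
        using J fin by (intro finite_Int disjI1 finite_SigmaI) auto
      then obtain D where D: "D \<in> C" "Sigma J A \<inter> \<Union>C \<subseteq> D"
        using finite_subset_Union_chain[OF _ _ False C, of "Sigma J A \<inter> \<Union>C"] by blast
      have "(S - D) `` J = (S - \<Union>C) `` J"
        using D J by (auto simp: S_def)
      moreover have "D \<in> \<D>"
        using D(1) sub by blast
      hence "card J \<le> card ((S - D) `` J)"
        using J by (simp add: \<D>_def)
      ultimately show ?thesis
        by simp
    qed
    moreover have "\<Union>C \<subseteq> S"
      using sub by (auto simp: \<D>_def)
    ultimately show "\<Union>C \<in> \<D>"
      by (simp add: \<D>_def)
  qed
  then obtain D where D: "D \<in> \<D>" and max: "\<And>X. X \<in> \<D> \<Longrightarrow> D \<subseteq> X \<Longrightarrow> X = D"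
    by blast
  define R where "R = S - D"
  have R: "R \<subseteq> S" and card_R: "\<And>J. J \<subseteq> I \<Longrightarrow> finite J \<Longrightarrow> card J \<le> card (R `` J)"
    using D by (auto simp: R_def \<D>_def)
  have fin_R: "finite (R `` J)" if "J \<subseteq> I" "finite J" for J
    using fin_img[OF that] R by (meson Image_mono finite_subset order_refl)
  \<comment> \<open>By maximality of \<open>D\<close>, removing (i, x) as well violates Hall's
    condition for some set. That set must contain i, and \<open>P\<close> is the rest of it.\<close>
  have critical: "\<exists>P. P \<subseteq> I \<and> finite P \<and> i \<notin> P \<and> card (R `` P \<union> (R `` {i} - {x})) \<le> card P"
    if "(i, x) \<in> R" for i x
  proof -
    have "insert (i, x) D \<notin> \<D>"
      using max[of "insert (i, x) D"] that by (auto simp: R_def)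
    moreover have "insert (i, x) D \<subseteq> S"
      using D that R by (auto simp: \<D>_def)
    moreover have "S - insert (i, x) D = R - {(i, x)}"
      by (auto simp: R_def)
    ultimately obtain J where J: "J \<subseteq> I" "finite J" "\<not> card J \<le> card ((R - {(i, x)}) `` J)"
      unfolding \<D>_def by auto
    have "i \<in> J"
    proof (rule ccontr)
      assume "i \<notin> J"
      hence "(R - {(i, x)}) `` J = R `` J" by auto
      thus False using J card_R by simp
    qed
    hence "(R - {(i, x)}) `` J = R `` (J - {i}) \<union> (R `` {i} - {x})"
      by auto
    hence "card (R `` (J - {i}) \<union> (R `` {i} - {x})) \<le> card (J - {i})"
      using J \<open>i \<in> J\<close> by simp
    thus ?thesis
      using J by (intro exI[of _ "J - {i}"]) auto
  qed
  \<comment> \<open>For x \<noteq> y the sets \<open>?U\<close> and \<open>?V\<close> together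
    contain all neighbours of i. Inclusion-exclusion and Hall's condition for
    \<open>insert i (P \<union> Q)\<close> and \<open>P \<inter> Q\<close> then make their sizes add
    up to at least |P| + |Q| + 1, against the choice of \<open>P\<close> and
    \<open>Q\<close>.\<close>
  have unique: "x = y" if xy: "(i, x) \<in> R" "(i, y) \<in> R" for i x y
  proof (rule ccontr)
    assume "x \<noteq> y"
    obtain P where P: "P \<subseteq> I" "finite P" "i \<notin> P" "card (R `` P \<union> (R `` {i} - {x})) \<le> card P"
      using critical[OF xy(1)] by blast
    obtain Q where Q: "Q \<subseteq> I" "finite Q" "i \<notin> Q" "card (R `` Q \<union> (R `` {i} - {y})) \<le> card Q"
      using critical[OF xy(2)] by blast
    let ?U = "R `` P \<union> (R `` {i} - {x})" and ?V = "R `` Q \<union> (R `` {i} - {y})"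
    have i: "i \<in> I"
      using xy(1) R by (auto simp: S_def)
    have fin_UV: "finite ?U" "finite ?V"
      using fin_R P Q i by auto
    have "R `` insert i (P \<union> Q) \<subseteq> ?U \<union> ?V" "R `` (P \<inter> Q) \<subseteq> ?U \<inter> ?V"
      using \<open>x \<noteq> y\<close> by auto
    hence "card (R `` insert i (P \<union> Q)) \<le> card (?U \<union> ?V)" "card (R `` (P \<inter> Q)) \<le> card (?U \<inter> ?V)"
      using fin_UV by (auto intro!: card_mono)
    moreover have "card (insert i (P \<union> Q)) \<le> card (R `` insert i (P \<union> Q))"
      using P(1,2) Q(1,2) i by (intro card_R) auto
    moreover have "card (P \<inter> Q) \<le> card (R `` (P \<inter> Q))"
      using P(1,2) by (intro card_R) auto
    moreover have "card (insert i (P \<union> Q)) = Suc (card (P \<union> Q))"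
      using P Q by simp
    moreover have "card ?U + card ?V = card (?U \<union> ?V) + card (?U \<inter> ?V)"
      using fin_UV by (rule card_Un_Int)
    moreover have "card P + card Q = card (P \<union> Q) + card (P \<inter> Q)"
      using P(2) Q(2) by (rule card_Un_Int)
    ultimately show False
      using P(4) Q(4) by linarith
  qed
  define \<phi> where "\<phi> i = (SOME x. (i, x) \<in> R)" for i
  have \<phi>: "(i, \<phi> i) \<in> R" if "i \<in> I" for i
  proof -
    have "card (R `` {i}) \<ge> 1"
      using card_R[of "{i}"] that by simp
    hence "R `` {i} \<noteq> {}"
      by auto
    thus ?thesis
      unfolding \<phi>_def by (auto intro: someI)
  qed
  show thesis
  proof
    show "inj_on \<phi> I"
    proof (rule inj_onI)
      fix i j assume ij: "i \<in> I" "j \<in> I" "\<phi> i = \<phi> j"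
      \<comment> \<open>A common value would be the only neighbour of both i and j, and Hall's
        condition for {i, j} leaves room for one index only.\<close>
      have "x = \<phi> i" if "(i, x) \<in> R \<or> (j, x) \<in> R" for x
        using that unique \<phi>[OF ij(1)] \<phi>[OF ij(2)] ij(3) by metis
      hence "R `` {i, j} \<subseteq> {\<phi> i}"
        by auto
      hence "card (R `` {i, j}) \<le> 1"
        using card_mono[of "{\<phi> i}"] by fastforce
      moreover have "card {i, j} \<le> card (R `` {i, j})"
        using ij by (intro card_R) auto
      ultimately show "i = j"
        by (cases "i = j") auto
    qed
    show "\<phi> i \<in> A i" if "i \<in> I" for i
      using \<phi>[OF that] R by (auto simp: S_def)
  qed
qed

section \<open>Invariant means, non-doubling sets and Foelner sets\<close>

lemma finitely_additive_UN:
  fixes \<nu> :: "'a set \<Rightarrow> real"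
  assumes add: "\<And>S T. \<lbrakk>S \<subseteq> \<Omega>; T \<subseteq> \<Omega>; S \<inter> T = {}\<rbrakk> \<Longrightarrow> \<nu> (S \<union> T) = \<nu> S + \<nu> T"
    and "finite J" "\<And>j. j \<in> J \<Longrightarrow> S j \<subseteq> \<Omega>" "disjoint_family_on S J"
  shows "\<nu> (\<Union>j\<in>J. S j) = (\<Sum>j\<in>J. \<nu> (S j))"
  using assms(2-)
proof (induction J)
  case empty
  show ?case using add[of "{}" "{}"] by simp
next
  case (insert j J)
  have "S j \<inter> (\<Union>i\<in>J. S i) = {}"
    using insert.prems(2) insert.hyps by (auto simp: disjoint_family_on_def)
  hence "\<nu> (S j \<union> (\<Union>i\<in>J. S i)) = \<nu> (S j) + \<nu> (\<Union>i\<in>J. S i)"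
    using insert.prems by (intro add) auto
  moreover have "\<nu> (\<Union>i\<in>J. S i) = (\<Sum>i\<in>J. \<nu> (S i))"
    using insert.prems by (intro insert.IH) (auto simp: disjoint_family_on_def)
  ultimately show ?case
    using insert.hyps by simp
qed

context group
begin

lemma finite_set_mult: "finite H \<Longrightarrow> finite K \<Longrightarrow> finite (H <#> K)"
  by (auto simp: set_mult_def)

lemma set_mult_nonempty: "H \<noteq> {} \<Longrightarrow> K \<noteq> {} \<Longrightarrow> H <#> K \<noteq> {}"
  by (auto simp: set_mult_def)

text \<open>Inversion carries right translation by g to left translation by the inverse of g. The
  passage is needed because amenability is stated with left translates and the Foelner condition
  with right ones.\<close>

lemma right_invariant_mean:
  assumes "amenable G"
  shows "\<exists>\<nu> :: 'a set \<Rightarrow> real.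
    (\<forall>S. S \<subseteq> carrier G \<longrightarrow> 0 \<le> \<nu> S) \<and> \<nu> (carrier G) = 1 \<and>
    (\<forall>S T. S \<subseteq> carrier G \<longrightarrow> T \<subseteq> carrier G \<longrightarrow> S \<inter> T = {} \<longrightarrow> \<nu> (S \<union> T) = \<nu> S + \<nu> T) \<and>
    (\<forall>g\<in>carrier G. \<forall>S. S \<subseteq> carrier G \<longrightarrow> \<nu> (S #> g) = \<nu> S)"
proof -
  obtain \<mu> :: "'a set \<Rightarrow> real" where \<mu>:
    "(\<forall>S. S \<subseteq> carrier G \<longrightarrow> 0 \<le> \<mu> S) \<and> \<mu> (carrier G) = 1 \<and>
     (\<forall>S T. S \<subseteq> carrier G \<longrightarrow> T \<subseteq> carrier G \<longrightarrow> S \<inter> T = {} \<longrightarrow> \<mu> (S \<union> T) = \<mu> S + \<mu> T) \<and>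
     (\<forall>g\<in>carrier G. \<forall>S. S \<subseteq> carrier G \<longrightarrow> \<mu> (g <# S) = \<mu> S)"
    using assms unfolding amenable_def by (rule exE)
  let ?inv = "m_inv G"
  have img: "?inv ` S \<subseteq> carrier G" if "S \<subseteq> carrier G" for S
    using that by auto
  have "?inv ` carrier G = carrier G"
    by (metis inv_closed inv_inv image_eqI subsetI image_subset_iff subset_antisym)
  hence total: "\<mu> (?inv ` carrier G) = 1"
    using \<mu> by simp
  have add: "\<mu> (?inv ` (S \<union> T)) = \<mu> (?inv ` S) + \<mu> (?inv ` T)"
    if ST: "S \<subseteq> carrier G" "T \<subseteq> carrier G" "S \<inter> T = {}" for S T
  proof -
    have "?inv ` S \<inter> ?inv ` T = ?inv ` (S \<inter> T)"
      by (rule inj_on_image_Int[OF inv_inj ST(1,2), symmetric])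
    thus ?thesis
      using \<mu> img[OF ST(1)] img[OF ST(2)] ST(3) by (simp add: image_Un)
  qed
  have invariant: "\<mu> (?inv ` (S #> g)) = \<mu> (?inv ` S)" if "g \<in> carrier G" "S \<subseteq> carrier G" for g S
  proof -
    have "?inv ` (S #> g) = (\<lambda>s. inv (s \<otimes> g)) ` S"
      by (auto simp: r_coset_def)
    also have "\<dots> = (\<lambda>s. inv g \<otimes> inv s) ` S"
      using that by (intro image_cong) (auto intro: inv_mult_group)
    also have "\<dots> = inv g <# (?inv ` S)"
      by (auto simp: l_coset_def)
    finally show ?thesis
      using \<mu> img[OF that(2)] that(1) by simp
  qed
  show ?thesis
    by (intro exI[of _ "\<lambda>S. \<mu> (?inv ` S)"] conjI allI impI ballI)
      (use \<mu> img total add invariant in simp_all)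
qed

text \<open>
  Otherwise Hall's theorem injects two copies of \<open>G\<close> into \<open>G\<close>, moving points by elements of \<open>K\<close> only.
  This is a paradoxical decomposition, which contradicts the invariant mean.
\<close>

lemma amenable_not_doubling:
  assumes "amenable G" and K: "finite K" "K \<subseteq> carrier G"
  shows "\<exists>F. finite F \<and> F \<noteq> {} \<and> F \<subseteq> carrier G \<and> card (F <#> K) < 2 * card F"
proof (rule ccontr)
  assume "\<not> ?thesis"
  hence doubling: "2 * card F \<le> card (F <#> K)" if "finite F" "F \<noteq> {}" "F \<subseteq> carrier G" for F
    using that by (meson not_le)
  \<comment> \<open>The Boolean labels the copy of the group. Since \<open>J\<close> has at most two
    points over each element of its projection, doubling for the projection gives Hall's condition
    for \<open>J\<close>.\<close>
  obtain \<phi> where \<phi>: "inj_on \<phi> (carrier G \<times> (UNIV :: bool set))"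
    "\<And>p. p \<in> carrier G \<times> UNIV \<Longrightarrow> \<phi> p \<in> fst p <# K"
  proof (rule hall_locally_finite[of "carrier G \<times> (UNIV :: bool set)" "\<lambda>p. fst p <# K"])
    show "finite (fst p <# K)" for p :: "'a \<times> bool"
      using K by (simp add: l_coset_def)
    fix J :: "('a \<times> bool) set"
    assume J: "J \<subseteq> carrier G \<times> UNIV" "finite J"
    show "card J \<le> card (\<Union>p\<in>J. fst p <# K)"
    proof (cases "J = {}")
      case False
      have "J \<subseteq> fst ` J \<times> UNIV"
        by force
      hence "card J \<le> card (fst ` J \<times> (UNIV :: bool set))"
        using J by (intro card_mono) auto
      also have "\<dots> = 2 * card (fst ` J)"
        by (simp add: card_cartesian_product)
      also have "\<dots> \<le> card (fst ` J <#> K)"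
        using J False by (intro doubling) auto
      also have "fst ` J <#> K = (\<Union>p\<in>J. fst p <# K)"
        by (simp add: set_mult_def l_coset_def)
      finally show ?thesis .
    qed simp
  qed blast
  obtain \<nu> :: "'a set \<Rightarrow> real" where \<nu>:
    "(\<forall>S. S \<subseteq> carrier G \<longrightarrow> 0 \<le> \<nu> S) \<and> \<nu> (carrier G) = 1 \<and>
     (\<forall>S T. S \<subseteq> carrier G \<longrightarrow> T \<subseteq> carrier G \<longrightarrow> S \<inter> T = {} \<longrightarrow> \<nu> (S \<union> T) = \<nu> S + \<nu> T) \<and>
     (\<forall>g\<in>carrier G. \<forall>S. S \<subseteq> carrier G \<longrightarrow> \<nu> (S #> g) = \<nu> S)"
    using right_invariant_mean[OF assms(1)] by (rule exE)
  have one: "\<nu> (carrier G) = 1"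
    using \<nu> by simp
  have add: "\<nu> (S \<union> T) = \<nu> S + \<nu> T" if "S \<subseteq> carrier G" "T \<subseteq> carrier G" "S \<inter> T = {}" for S T
    using \<nu> that by simp
  \<comment> \<open>The piece of copy \<open>b\<close> that \<phi> moves by \<open>k\<close>. For
    fixed \<open>b\<close> the pieces partition the group, so they have total mass 1; their
    translates are disjoint even across both copies, since \<phi> is injective. Mass 2 would thus
    fit into mass 1.\<close>
  define D where "D b k = {x \<in> carrier G. \<phi> (x, b) = x \<otimes> k}" for b k
  have D: "D b k \<subseteq> carrier G" for b k
    by (auto simp: D_def)
  have Dk: "D b k #> k \<subseteq> carrier G" if "k \<in> K" for b k
    using r_coset_subset_G[OF D] that K by blast
  have cover: "(\<Sum>k\<in>K. \<nu> (D b k)) = 1" for b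
  proof -
    have "disjoint_family_on (D b) K"
    proof (unfold disjoint_family_on_def, intro ballI impI)
      fix k l assume kl: "k \<in> K" "l \<in> K" "k \<noteq> l"
      show "D b k \<inter> D b l = {}"
        using kl K(2) by (auto simp: D_def subset_iff)
    qed
    hence "(\<Sum>k\<in>K. \<nu> (D b k)) = \<nu> (\<Union>k\<in>K. D b k)"
      using finitely_additive_UN[of "carrier G" \<nu> K "D b"] add K(1) D by simp
    moreover have "(\<Union>k\<in>K. D b k) = carrier G"
      using \<phi>(2) by (fastforce simp: D_def l_coset_def)
    ultimately show ?thesis
      using one by simp
  qed
  let ?J = "(UNIV :: bool set) \<times> K" and ?S = "\<lambda>(b, k). D b k #> k"
  have "disjoint_family_on ?S ?J"
  proof (unfold disjoint_family_on_def, intro ballI impI)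
    fix p q assume pq: "p \<in> ?J" "q \<in> ?J" "p \<noteq> q"
    obtain b k c l where bk: "p = (b, k)" "q = (c, l)" "k \<in> K" "l \<in> K"
      using pq by auto
    have False if z: "z \<in> D b k #> k" "z \<in> D c l #> l" for z
    proof -
      obtain x where x: "x \<in> carrier G" "\<phi> (x, b) = x \<otimes> k" "z = x \<otimes> k"
        using z(1) unfolding r_coset_def D_def by blast
      obtain y where y: "y \<in> carrier G" "\<phi> (y, c) = y \<otimes> l" "z = y \<otimes> l"
        using z(2) unfolding r_coset_def D_def by blast
      have "(x, b) = (y, c)"
        using x y by (intro inj_onD[OF \<phi>(1)]) auto
      moreover have "k = l"
        using calculation x y bk(3,4) K(2) Units_l_cancel[of x k l] by (auto simp: subset_iff)
      ultimately show False
        using pq(3) bk by simp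
    qed
    thus "?S p \<inter> ?S q = {}"
      using bk by auto
  qed
  moreover have "?S p \<subseteq> carrier G" if "p \<in> ?J" for p
    using that Dk by auto
  ultimately have "\<nu> (\<Union>p\<in>?J. ?S p) = (\<Sum>p\<in>?J. \<nu> (?S p))"
    using finitely_additive_UN[of "carrier G" \<nu> ?J ?S] add K(1) by simp
  also have "\<dots> = (\<Sum>b\<in>UNIV. \<Sum>k\<in>K. \<nu> (D b k #> k))"
    by (simp add: sum.cartesian_product case_prod_unfold)
  also have "\<dots> = (\<Sum>b\<in>(UNIV :: bool set). \<Sum>k\<in>K. \<nu> (D b k))"
    using K(2) D by (intro sum.cong refl) (use \<nu> in \<open>auto simp: subset_iff\<close>)
  also have "\<dots> = 2"
    using cover by simp
  finally have two: "\<nu> (\<Union>p\<in>?J. ?S p) = 2" .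
  have sub: "(\<Union>p\<in>?J. ?S p) \<subseteq> carrier G"
    using Dk by auto
  have "\<nu> (carrier G) = \<nu> (\<Union>p\<in>?J. ?S p) + \<nu> (carrier G - (\<Union>p\<in>?J. ?S p))"
    using add[OF sub, of "carrier G - (\<Union>p\<in>?J. ?S p)"] sub by (simp add: Un_absorb1)
  moreover have "0 \<le> \<nu> (carrier G - (\<Union>p\<in>?J. ?S p))"
    using \<nu> by simp
  ultimately show False
    using one two by simp
qed

text \<open>If every finite set failed the condition for some g in \<open>K\<close>, multiplication
  by \<open>K\<close> with the unit added would enlarge each finite set by the factor 1 +
  \<epsilon>. Iterating until the factor exceeds 2 contradicts
  \<open>amenable_not_doubling\<close>.\<close>

lemma amenable_folner_set:
  fixes \<epsilon> :: real
  assumes "amenable G" and K: "finite K" "K \<subseteq> carrier G" and "\<epsilon> > 0"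
  shows "\<exists>F. finite F \<and> F \<noteq> {} \<and> F \<subseteq> carrier G \<and>
           (\<forall>g\<in>K. real (card ((F #> g) - F)) \<le> \<epsilon> * real (card F))"
proof (rule ccontr)
  assume neg: "\<not> ?thesis"
  let ?K = "insert \<one> K"
  have grow: "(1 + \<epsilon>) * real (card F) \<le> real (card (F <#> ?K))"
    if F: "finite F" "F \<noteq> {}" "F \<subseteq> carrier G" for F
  proof -
    obtain g where g: "g \<in> K" "\<epsilon> * real (card F) < real (card ((F #> g) - F))"
      using neg F by (meson not_le)
    have "F \<union> ((F #> g) - F) \<subseteq> F <#> ?K"
      using F g K by (force simp: set_mult_def r_coset_def)
    hence "card (F \<union> ((F #> g) - F)) \<le> card (F <#> ?K)"
      using F K by (intro card_mono finite_set_mult) auto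
    moreover have "card (F \<union> ((F #> g) - F)) = card F + card ((F #> g) - F)"
      using F by (intro card_Un_disjoint) (auto simp: r_coset_def)
    ultimately show ?thesis
      using g by (simp add: algebra_simps)
  qed
  have "\<exists>L. finite L \<and> L \<noteq> {} \<and> L \<subseteq> carrier G \<and>
          (\<forall>F. finite F \<longrightarrow> F \<noteq> {} \<longrightarrow> F \<subseteq> carrier G \<longrightarrow> (1 + \<epsilon>) ^ n * real (card F) \<le> real (card (F <#> L)))" for n
  proof (induction n)
    case 0
    have "F <#> {\<one>} = F" if "F \<subseteq> carrier G" for F
      using that by (force simp: set_mult_def)
    thus ?case
      by (intro exI[of _ "{\<one>}"]) auto
  next
    case (Suc n)
    then obtain L where L: "finite L" "L \<noteq> {}" "L \<subseteq> carrier G"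
      "\<And>F. finite F \<Longrightarrow> F \<noteq> {} \<Longrightarrow> F \<subseteq> carrier G \<Longrightarrow> (1 + \<epsilon>) ^ n * real (card F) \<le> real (card (F <#> L))"
      by blast
    have "(1 + \<epsilon>) ^ Suc n * real (card F) \<le> real (card (F <#> (L <#> ?K)))"
      if F: "finite F" "F \<noteq> {}" "F \<subseteq> carrier G" for F
    proof -
      have "(1 + \<epsilon>) ^ Suc n * real (card F) \<le> (1 + \<epsilon>) * real (card (F <#> L))"
        using mult_left_mono[OF L(4)[OF F], of "1 + \<epsilon>"] \<open>\<epsilon> > 0\<close> by simp
      also have "\<dots> \<le> real (card ((F <#> L) <#> ?K))"
        using F L by (intro grow finite_set_mult set_mult_nonempty set_mult_closed)
      also have "(F <#> L) <#> ?K = F <#> (L <#> ?K)"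
        using F L K by (intro set_mult_assoc) auto
      finally show ?thesis .
    qed
    moreover have "finite (L <#> ?K)" "L <#> ?K \<noteq> {}" "L <#> ?K \<subseteq> carrier G"
      using L(1-3) K by (simp_all add: finite_set_mult set_mult_nonempty set_mult_closed)
    ultimately show ?case
      by blast
  qed
  moreover obtain n where "2 < (1 + \<epsilon>) ^ n"
    using real_arch_pow[of "1 + \<epsilon>" 2] \<open>\<epsilon> > 0\<close> by auto
  ultimately obtain L where L: "finite L" "L \<subseteq> carrier G"
    "\<And>F. finite F \<Longrightarrow> F \<noteq> {} \<Longrightarrow> F \<subseteq> carrier G \<Longrightarrow> (1 + \<epsilon>) ^ n * real (card F) \<le> real (card (F <#> L))"
    by meson
  obtain F where F: "finite F" "F \<noteq> {}" "F \<subseteq> carrier G" "card (F <#> L) < 2 * card F"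
    using amenable_not_doubling[OF assms(1) L(1,2)] by blast
  have "2 * real (card F) \<le> (1 + \<epsilon>) ^ n * real (card F)"
    using \<open>2 < (1 + \<epsilon>) ^ n\<close> by (intro mult_right_mono) auto
  also have "\<dots> \<le> real (card (F <#> L))"
    using F by (intro L)
  finally show False
    using F(4) by linarith
qed

text \<open>The group may be uncountable, so a sequence would not do: the index records a finite set
  of translations together with a tolerance 1/(n + 1).\<close>

lemma amenable_folner_net:
  assumes "amenable G"
  obtains E where "right_folner_net G (finite_subsets_at_top (carrier G) \<times>\<^sub>F sequentially) E"
proof -
  \<comment> \<open>The conditions on \<open>K\<close> stand under the quantifier so that a choice
    function exists on all pairs; eventually the index satisfies them.\<close>
  have "\<exists>F. finite K \<longrightarrow> K \<subseteq> carrier G \<longrightarrow> finite F \<and> F \<noteq> {} \<and> F \<subseteq> carrier G \<and>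
          (\<forall>g\<in>K. real (card ((F #> g) - F)) \<le> inverse (real (Suc n)) * real (card F))" for K and n :: nat
    using amenable_folner_set[OF assms, of K "inverse (real (Suc n))"] by auto
  then obtain E where E: "\<And>K n. finite K \<Longrightarrow> K \<subseteq> carrier G \<Longrightarrow>
      finite (E K n) \<and> E K n \<noteq> {} \<and> E K n \<subseteq> carrier G \<and>
      (\<forall>g\<in>K. real (card ((E K n #> g) - E K n)) \<le> inverse (real (Suc n)) * real (card (E K n)))"
    by metis
  let ?I = "finite_subsets_at_top (carrier G) \<times>\<^sub>F sequentially"
  let ?E = "\<lambda>(K, n). E K n"
  show thesis
  proof (rule that[of ?E], unfold right_folner_net_def, intro conjI ballI)
    show "?I \<noteq> bot"
      by (simp add: prod_filter_eq_bot)
    have ev: "\<forall>\<^sub>F K in finite_subsets_at_top (carrier G). finite K \<and> K \<subseteq> carrier G \<and> S \<subseteq> K"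
      if "finite S" "S \<subseteq> carrier G" for S
      unfolding eventually_finite_subsets_at_top using that by blast
    have ev_fst: "\<forall>\<^sub>F p in ?I. finite (fst p) \<and> fst p \<subseteq> carrier G \<and> S \<subseteq> fst p"
      if "finite S" "S \<subseteq> carrier G" for S
      using ev[OF that]
      by (rule eventually_compose_filterlim) (simp add: filterlim_def filtermap_fst_prod_filter)
    show "\<forall>\<^sub>F p in ?I. finite (?E p) \<and> ?E p \<noteq> {} \<and> ?E p \<subseteq> carrier G"
    proof -
      have "\<forall>\<^sub>F p in ?I. finite (fst p) \<and> fst p \<subseteq> carrier G"
        using ev_fst[of "{}"] by simp
      thus ?thesis
        by (rule eventually_mono) (use E in \<open>auto simp: case_prod_unfold\<close>)
    qed
    fix g assume g: "g \<in> carrier G"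
    have ev_g: "\<forall>\<^sub>F p in ?I. finite (fst p) \<and> fst p \<subseteq> carrier G \<and> {g} \<subseteq> fst p"
      using g by (intro ev_fst) auto
    have lim: "((\<lambda>p :: 'a set \<times> nat. inverse (real (Suc (snd p)))) \<longlongrightarrow> 0) ?I"
      using LIMSEQ_inverse_real_of_nat
      by (rule filterlim_compose) (simp add: filterlim_def filtermap_snd_prod_filter)
    have bound: "\<forall>\<^sub>F p in ?I. real (card ((?E p #> g) - ?E p)) / real (card (?E p))
        \<le> inverse (real (Suc (snd p)))"
      using ev_g
    proof (rule eventually_mono)
      fix p :: "'a set \<times> nat" assume p: "finite (fst p) \<and> fst p \<subseteq> carrier G \<and> {g} \<subseteq> fst p"
      have "real (card ((?E p #> g) - ?E p)) \<le> inverse (real (Suc (snd p))) * real (card (?E p))"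
        "real (card (?E p)) > 0"
        using E[of "fst p" "snd p"] p by (auto simp: case_prod_unfold card_gt_0_iff)
      thus "real (card ((?E p #> g) - ?E p)) / real (card (?E p)) \<le> inverse (real (Suc (snd p)))"
        by (simp add: divide_le_eq)
    qed
    show "((\<lambda>p. real (card ((?E p #> g) - ?E p)) / real (card (?E p))) \<longlongrightarrow> 0) ?I"
      by (rule tendsto_sandwich[OF always_eventually bound tendsto_const lim]) simp
  qed
qed

end

section \<open>The infimum rule\<close>

lemma (in comm_group) hom_finprod:
  assumes h: "h \<in> hom G G" and y: "y \<in> F \<rightarrow> carrier G"
  shows "h (finprod G y F) = (\<Otimes>i\<in>F. h (y i))"
  using y
proof (induction F rule: infinite_finite_induct)
  case (insert i F)
  have "h (y i \<otimes> finprod G y F) = h (y i) \<otimes> h (finprod G y F)"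
    using insert.prems by (intro hom_mult[OF h] finprod_closed) auto
  moreover have "(\<lambda>i. h (y i)) \<in> F \<rightarrow> carrier G" "h (y i) \<in> carrier G"
    using insert.prems h by (auto simp: hom_def Pi_def)
  ultimately show ?case
    using insert by (simp add: Pi_def)
qed (use hom_one[OF h is_group is_group] in auto)

text \<open>Commutativity lets equal factors be collected, so only the number of occurrences of each
  x matters. This is the source of polynomial growth when the acting elements are trivial on the
  group.\<close>

lemma (in comm_group) finprod_eq_prod_multiplicities:
  assumes "finite E" "finite X" "X \<subseteq> carrier G" and y: "y \<in> E \<rightarrow> X"
  shows "finprod G y E = (\<Otimes>x\<in>X. x [^] card {e \<in> E. y e = x})"
proof -
  have "finprod G y (\<Union>x\<in>X. {e \<in> E. y e = x}) = (\<Otimes>x\<in>X. finprod G y {e \<in> E. y e = x})"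
    using assms by (intro finprod_UN_disjoint) (auto simp: pairwise_def disjnt_def)
  moreover have "(\<Union>x\<in>X. {e \<in> E. y e = x}) = E"
    using y by auto
  moreover have "(\<Otimes>x\<in>X. finprod G y {e \<in> E. y e = x}) = (\<Otimes>x\<in>X. x [^] card {e \<in> E. y e = x})"
  proof (rule finprod_cong')
    fix x assume x: "x \<in> X"
    have "finprod G y {e \<in> E. y e = x} = (\<Otimes>e\<in>{e \<in> E. y e = x}. x)"
      using x assms(3) by (intro finprod_cong') auto
    thus "finprod G y {e \<in> E. y e = x} = x [^] card {e \<in> E. y e = x}"
      using x assms(3) by (simp add: finprod_const subset_iff)
  qed (use assms(3) in auto)
  ultimately show ?thesis
    by simp
qed

section \<open>Trajectories of an action and their translates\<close>

locale endo_action = G: group G + A: comm_group A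
  for G :: "('g, 'm) monoid_scheme" and A :: "('a, 'n) monoid_scheme" +
  fixes \<alpha> :: "'g \<Rightarrow> 'a \<Rightarrow> 'a"
  assumes action: "left_action G A \<alpha>"
begin

lemma action_hom: "g \<in> carrier G \<Longrightarrow> \<alpha> g \<in> hom A A"
  using action by (simp add: left_action_def)

lemma action_closed: "g \<in> carrier G \<Longrightarrow> a \<in> carrier A \<Longrightarrow> \<alpha> g a \<in> carrier A"
  using action_hom by (auto simp: hom_def)

lemma action_mult:
  "g \<in> carrier G \<Longrightarrow> h \<in> carrier G \<Longrightarrow> a \<in> carrier A \<Longrightarrow> \<alpha> (g \<otimes>\<^bsub>G\<^esub> h) a = \<alpha> g (\<alpha> h a)"
  using action by (simp add: left_action_def)

lemma action_image:
  "g \<in> carrier G \<Longrightarrow> X \<subseteq> carrier A \<Longrightarrow> \<alpha> g ` X \<subseteq> carrier A"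
  using action_closed by blast

text \<open>Choosing arguments in \<open>X\<close> instead of values in the images makes reindexing
  by translation possible.\<close>

lemma trajectory_param:
  assumes F: "F \<subseteq> carrier G" and X: "X \<subseteq> carrier A"
  shows "trajectory A \<alpha> F X = {(\<Otimes>\<^bsub>A\<^esub>g\<in>F. \<alpha> g (x g)) | x. x \<in> F \<rightarrow> X}"
proof (intro equalityI subsetI)
  fix v assume "v \<in> trajectory A \<alpha> F X"
  then obtain y where y: "\<forall>g\<in>F. y g \<in> \<alpha> g ` X" "v = finprod A y F"
    by (auto simp: trajectory_def)
  define x where "x g = (SOME a. a \<in> X \<and> y g = \<alpha> g a)" for g
  have x: "x g \<in> X \<and> y g = \<alpha> g (x g)" if "g \<in> F" for g
  proof -
    have "\<exists>a. a \<in> X \<and> y g = \<alpha> g a"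
      using y(1) that by blast
    thus ?thesis
      unfolding x_def by (rule someI_ex)
  qed
  have "finprod A y F = (\<Otimes>\<^bsub>A\<^esub>g\<in>F. \<alpha> g (x g))"
    using x F X by (intro A.finprod_cong') (auto intro!: action_closed)
  thus "v \<in> {(\<Otimes>\<^bsub>A\<^esub>g\<in>F. \<alpha> g (x g)) | x. x \<in> F \<rightarrow> X}"
    using x y by blast
qed (auto simp: trajectory_def)

lemma trajectory_subset_carrier:
  assumes "F \<subseteq> carrier G" "X \<subseteq> carrier A"
  shows "trajectory A \<alpha> F X \<subseteq> carrier A"
  unfolding trajectory_eq_set_prod
  using assms by (intro A.set_prod_subset_carrier action_image) auto

text \<open>The identity \<alpha>(gk) = \<alpha>(g)\<alpha>(k) lets the endomorphism \<alpha>(g) be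
  pulled out of the product.\<close>

lemma trajectory_l_coset:
  assumes g: "g \<in> carrier G" and K: "K \<subseteq> carrier G" and X: "X \<subseteq> carrier A"
  shows "trajectory A \<alpha> (g <#\<^bsub>G\<^esub> K) X = \<alpha> g ` trajectory A \<alpha> K X"
proof -
  have gK: "g <#\<^bsub>G\<^esub> K = (\<lambda>k. g \<otimes>\<^bsub>G\<^esub> k) ` K"
    by (auto simp: l_coset_def)
  have inj: "inj_on (\<lambda>k. g \<otimes>\<^bsub>G\<^esub> k) K"
    using G.inj_on_cmult[OF g] K by (rule inj_on_subset)
  have shift: "(\<Otimes>\<^bsub>A\<^esub>h\<in>g <#\<^bsub>G\<^esub> K. \<alpha> h (x h)) = \<alpha> g (\<Otimes>\<^bsub>A\<^esub>k\<in>K. \<alpha> k (x (g \<otimes>\<^bsub>G\<^esub> k)))"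
    if x: "\<And>k. k \<in> K \<Longrightarrow> x (g \<otimes>\<^bsub>G\<^esub> k) \<in> X" for x
  proof -
    have xA: "x (g \<otimes>\<^bsub>G\<^esub> k) \<in> carrier A" and kG: "k \<in> carrier G" if "k \<in> K" for k
      using x[OF that] that K X by auto
    have "(\<Otimes>\<^bsub>A\<^esub>h\<in>g <#\<^bsub>G\<^esub> K. \<alpha> h (x h)) = (\<Otimes>\<^bsub>A\<^esub>k\<in>K. \<alpha> (g \<otimes>\<^bsub>G\<^esub> k) (x (g \<otimes>\<^bsub>G\<^esub> k)))"
      unfolding gK using xA kG g by (intro A.finprod_reindex inj) (auto intro!: action_closed)
    also have "\<dots> = (\<Otimes>\<^bsub>A\<^esub>k\<in>K. \<alpha> g (\<alpha> k (x (g \<otimes>\<^bsub>G\<^esub> k))))"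
      using xA kG g by (intro A.finprod_cong') (auto intro!: action_closed action_mult)
    also have "\<dots> = \<alpha> g (\<Otimes>\<^bsub>A\<^esub>k\<in>K. \<alpha> k (x (g \<otimes>\<^bsub>G\<^esub> k)))"
      using xA kG g by (intro A.hom_finprod[symmetric] action_hom) (auto intro!: action_closed)
    finally show ?thesis .
  qed
  have gK_sub: "g <#\<^bsub>G\<^esub> K \<subseteq> carrier G"
    using g K by (rule G.l_coset_subset_G[rotated])
  show ?thesis
    unfolding trajectory_param[OF gK_sub X] trajectory_param[OF K X]
  proof (intro equalityI subsetI)
    fix v assume "v \<in> {(\<Otimes>\<^bsub>A\<^esub>h\<in>g <#\<^bsub>G\<^esub> K. \<alpha> h (x h)) | x. x \<in> (g <#\<^bsub>G\<^esub> K) \<rightarrow> X}"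
    then obtain x where x: "x \<in> (g <#\<^bsub>G\<^esub> K) \<rightarrow> X" "v = (\<Otimes>\<^bsub>A\<^esub>h\<in>g <#\<^bsub>G\<^esub> K. \<alpha> h (x h))"
      by blast
    have xk: "x (g \<otimes>\<^bsub>G\<^esub> k) \<in> X" if "k \<in> K" for k
      using x(1) that gK by auto
    show "v \<in> \<alpha> g ` {(\<Otimes>\<^bsub>A\<^esub>k\<in>K. \<alpha> k (x k)) | x. x \<in> K \<rightarrow> X}"
    proof (rule image_eqI)
      show "v = \<alpha> g (\<Otimes>\<^bsub>A\<^esub>k\<in>K. \<alpha> k (x (g \<otimes>\<^bsub>G\<^esub> k)))"
        using shift[of x] xk x(2) by simp
      show "(\<Otimes>\<^bsub>A\<^esub>k\<in>K. \<alpha> k (x (g \<otimes>\<^bsub>G\<^esub> k))) \<in> {(\<Otimes>\<^bsub>A\<^esub>k\<in>K. \<alpha> k (x k)) | x. x \<in> K \<rightarrow> X}"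
        using xk by (intro CollectI exI[of _ "\<lambda>k. x (g \<otimes>\<^bsub>G\<^esub> k)"]) simp
    qed
  next
    fix v assume "v \<in> \<alpha> g ` {(\<Otimes>\<^bsub>A\<^esub>k\<in>K. \<alpha> k (x k)) | x. x \<in> K \<rightarrow> X}"
    then obtain x where x: "x \<in> K \<rightarrow> X" "v = \<alpha> g (\<Otimes>\<^bsub>A\<^esub>k\<in>K. \<alpha> k (x k))"
      by blast
    define z where "z h = x (inv\<^bsub>G\<^esub> g \<otimes>\<^bsub>G\<^esub> h)" for h
    have z: "z (g \<otimes>\<^bsub>G\<^esub> k) = x k" if "k \<in> K" for k
      using that g K by (simp add: z_def G.m_assoc[symmetric] subset_iff)
    have zX: "z (g \<otimes>\<^bsub>G\<^esub> k) \<in> X" if "k \<in> K" for k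
      using z[OF that] x(1) that by auto
    have "(\<Otimes>\<^bsub>A\<^esub>k\<in>K. \<alpha> k (x k)) = (\<Otimes>\<^bsub>A\<^esub>k\<in>K. \<alpha> k (z (g \<otimes>\<^bsub>G\<^esub> k)))"
      using z zX K X by (intro A.finprod_cong') (auto intro!: action_closed)
    hence "v = (\<Otimes>\<^bsub>A\<^esub>h\<in>g <#\<^bsub>G\<^esub> K. \<alpha> h (z h))"
      using shift[of z] zX x(2) by simp
    moreover have "z \<in> (g <#\<^bsub>G\<^esub> K) \<rightarrow> X"
      using zX gK by auto
    ultimately show "v \<in> {(\<Otimes>\<^bsub>A\<^esub>h\<in>g <#\<^bsub>G\<^esub> K. \<alpha> h (x h)) | x. x \<in> (g <#\<^bsub>G\<^esub> K) \<rightarrow> X}"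
      by blast
  qed
qed

text \<open>No net enters here, so once this is shown to be the limit along an arbitrary right
  Foelner net, independence of the net comes for free.\<close>

definition entropy_rate :: "'a set \<Rightarrow> real" where
  "entropy_rate X = (INF K\<in>{K. finite K \<and> K \<noteq> {} \<and> K \<subseteq> carrier G}.
     ln (real (card (trajectory A \<alpha> K X))) / real (card K))"

section \<open>The entropy rate as a limit, and its vanishing for infinite kernels\<close>

context
  fixes X :: "'a set"
  assumes X: "X \<subseteq> carrier A" "finite X" "X \<noteq> {}"
begin

lemma finite_trajectory:
  assumes "finite F" "F \<subseteq> carrier G"
  shows "finite (trajectory A \<alpha> F X)"
  unfolding trajectory_eq_set_prod
  using assms X by (intro A.finite_set_prod action_image) auto

lemma trajectory_nonempty: "trajectory A \<alpha> F X \<noteq> {}"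
  unfolding trajectory_eq_set_prod using X by (intro A.set_prod_nonempty) auto

lemma card_trajectory_pos:
  assumes "finite F" "F \<subseteq> carrier G"
  shows "card (trajectory A \<alpha> F X) > 0"
  using finite_trajectory[OF assms] trajectory_nonempty by (simp add: card_gt_0_iff)

lemma card_trajectory_mono:
  assumes "F \<subseteq> E" "finite E" "E \<subseteq> carrier G"
  shows "card (trajectory A \<alpha> F X) \<le> card (trajectory A \<alpha> E X)"
  unfolding trajectory_eq_set_prod
  using assms X by (intro A.card_set_prod_mono conjI action_image) auto

text \<open>The translates jK with j in the product of \<open>F\<close> and the inverses of
  \<open>K\<close> cover each x in \<open>F\<close> exactly |K| times, namely for j = x k^-1. Each
  trace of such a translate on \<open>F\<close> has a trajectory no larger than that of jK, which is
  an image of the trajectory of \<open>K\<close>.\<close>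

lemma ln_card_trajectory_cover:
  assumes F: "finite F" "F \<subseteq> carrier G" and K: "finite K" "K \<subseteq> carrier G"
  shows "real (card K) * ln (real (card (trajectory A \<alpha> F X)))
    \<le> real (card (F <#>\<^bsub>G\<^esub> set_inv\<^bsub>G\<^esub> K)) * ln (real (card (trajectory A \<alpha> K X)))"
proof -
  let ?J = "F <#>\<^bsub>G\<^esub> set_inv\<^bsub>G\<^esub> K"
  have J: "finite ?J" "?J \<subseteq> carrier G"
    using F K by (auto simp: set_mult_def SET_INV_def)
  have "real (card K) * ln (real (card (set_prod A (\<lambda>g. \<alpha> g ` X) F)))
      \<le> (\<Sum>j\<in>?J. ln (real (card (set_prod A (\<lambda>g. \<alpha> g ` X) ((j <#\<^bsub>G\<^esub> K) \<inter> F)))))"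
  proof (rule A.set_prod_cover)
    show "\<alpha> g ` X \<subseteq> carrier A \<and> finite (\<alpha> g ` X) \<and> \<alpha> g ` X \<noteq> {}" if "g \<in> F" for g
      using that F X by (intro conjI action_image) auto
    show "card {j \<in> ?J. x \<in> j <#\<^bsub>G\<^esub> K} = card K" if x: "x \<in> F" for x
    proof -
      have xG: "x \<in> carrier G" using x F by auto
      have "{j \<in> ?J. x \<in> j <#\<^bsub>G\<^esub> K} = (\<lambda>k. x \<otimes>\<^bsub>G\<^esub> inv\<^bsub>G\<^esub> k) ` K"
      proof (intro equalityI subsetI)
        fix j assume "j \<in> {j \<in> ?J. x \<in> j <#\<^bsub>G\<^esub> K}"
        then obtain k where "j \<in> carrier G" "k \<in> K" "x = j \<otimes>\<^bsub>G\<^esub> k"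
          using J by (auto simp: l_coset_def)
        hence "j = x \<otimes>\<^bsub>G\<^esub> inv\<^bsub>G\<^esub> k"
          using K by (simp add: G.m_assoc subset_iff)
        thus "j \<in> (\<lambda>k. x \<otimes>\<^bsub>G\<^esub> inv\<^bsub>G\<^esub> k) ` K"
          using \<open>k \<in> K\<close> by blast
      next
        fix j assume "j \<in> (\<lambda>k. x \<otimes>\<^bsub>G\<^esub> inv\<^bsub>G\<^esub> k) ` K"
        then obtain k where k: "k \<in> K" "j = x \<otimes>\<^bsub>G\<^esub> inv\<^bsub>G\<^esub> k"
          by blast
        hence "x = j \<otimes>\<^bsub>G\<^esub> k"
          using K xG by (simp add: G.m_assoc subset_iff)
        thus "j \<in> {j \<in> ?J. x \<in> j <#\<^bsub>G\<^esub> K}"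
          using k x by (auto simp: set_mult_def SET_INV_def l_coset_def)
      qed
      moreover have "inj_on (\<lambda>k. x \<otimes>\<^bsub>G\<^esub> inv\<^bsub>G\<^esub> k) K"
      proof (rule inj_onI)
        fix k l assume kl: "k \<in> K" "l \<in> K" "x \<otimes>\<^bsub>G\<^esub> inv\<^bsub>G\<^esub> k = x \<otimes>\<^bsub>G\<^esub> inv\<^bsub>G\<^esub> l"
        hence "inv\<^bsub>G\<^esub> k = inv\<^bsub>G\<^esub> l"
          using xG K by (simp add: subset_iff)
        thus "k = l"
          using kl K by (metis G.inv_inv subsetD)
      qed
      ultimately show ?thesis
        by (simp add: card_image)
    qed
  qed (use F J in auto)
  also have "\<dots> \<le> (\<Sum>j\<in>?J. ln (real (card (trajectory A \<alpha> K X))))"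
  proof (rule sum_mono)
    fix j assume "j \<in> ?J"
    hence j: "j \<in> carrier G" using J by auto
    have jK: "finite (j <#\<^bsub>G\<^esub> K)" "j <#\<^bsub>G\<^esub> K \<subseteq> carrier G"
      using K j by (auto simp: l_coset_def)
    have "card (trajectory A \<alpha> ((j <#\<^bsub>G\<^esub> K) \<inter> F) X) \<le> card (trajectory A \<alpha> (j <#\<^bsub>G\<^esub> K) X)"
      using jK by (intro card_trajectory_mono) auto
    also have "\<dots> \<le> card (trajectory A \<alpha> K X)"
      unfolding trajectory_l_coset[OF j K(2) X(1)] by (intro card_image_le finite_trajectory K)
    finally have "card (trajectory A \<alpha> ((j <#\<^bsub>G\<^esub> K) \<inter> F) X) \<le> card (trajectory A \<alpha> K X)" .
    moreover have "card (trajectory A \<alpha> ((j <#\<^bsub>G\<^esub> K) \<inter> F) X) > 0"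
      using F by (intro card_trajectory_pos) auto
    ultimately show "ln (real (card (set_prod A (\<lambda>g. \<alpha> g ` X) ((j <#\<^bsub>G\<^esub> K) \<inter> F))))
        \<le> ln (real (card (trajectory A \<alpha> K X)))"
      unfolding trajectory_eq_set_prod by simp
  qed
  finally show ?thesis
    unfolding trajectory_eq_set_prod by simp
qed

lemma entropy_rate_bdd_below:
  "bdd_below ((\<lambda>K. ln (real (card (trajectory A \<alpha> K X))) / real (card K)) `
     {K. finite K \<and> K \<noteq> {} \<and> K \<subseteq> carrier G})"
proof (intro bdd_belowI2[where m = 0])
  fix K assume "K \<in> {K. finite K \<and> K \<noteq> {} \<and> K \<subseteq> carrier G}"
  hence "card (trajectory A \<alpha> K X) > 0"
    by (intro card_trajectory_pos) auto
  thus "0 \<le> ln (real (card (trajectory A \<alpha> K X))) / real (card K)"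
    by (simp add: Suc_leI)
qed

lemma entropy_rate_le:
  assumes "finite K" "K \<noteq> {}" "K \<subseteq> carrier G"
  shows "entropy_rate X \<le> ln (real (card (trajectory A \<alpha> K X))) / real (card K)"
  unfolding entropy_rate_def using assms by (intro cINF_lower entropy_rate_bdd_below) auto

lemma entropy_rate_nonneg: "0 \<le> entropy_rate X"
  unfolding entropy_rate_def
proof (rule cINF_greatest)
  show "{K. finite K \<and> K \<noteq> {} \<and> K \<subseteq> carrier G} \<noteq> {}"
    using G.one_closed by (auto intro!: exI[of _ "{\<one>\<^bsub>G\<^esub>}"])
  fix K assume "K \<in> {K. finite K \<and> K \<noteq> {} \<and> K \<subseteq> carrier G}"
  hence "card (trajectory A \<alpha> K X) > 0"
    by (intro card_trajectory_pos) auto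
  thus "0 \<le> ln (real (card (trajectory A \<alpha> K X))) / real (card K)"
    by (simp add: Suc_leI)
qed

text \<open>The infimum bounds the quotients from below along the net. For the upper bound take
  \<open>K\<close> with quotient near the infimum: the cover estimate costs the factor |F K^-1| /
  |F|, which tends to at most 1 by the Foelner condition for the inverses of elements of
  \<open>K\<close>.\<close>

lemma entropy_limit_entropy_rate:
  assumes folner: "right_folner_net G I F"
  shows "entropy_limit A \<alpha> X I F (entropy_rate X)"
  unfolding entropy_limit_def
proof (rule order_tendstoI)
  let ?f = "\<lambda>K. ln (real (card (trajectory A \<alpha> K X))) / real (card K)"
  have ev: "\<forall>\<^sub>F i in I. finite (F i) \<and> F i \<noteq> {} \<and> F i \<subseteq> carrier G"
    using folner by (simp add: right_folner_net_def)
  show "\<forall>\<^sub>F i in I. a < ?f (F i)" if "a < entropy_rate X" for a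
    using ev
  proof eventually_elim
    case (elim i)
    thus ?case
      using entropy_rate_le[of "F i"] that by simp
  qed
  show "\<forall>\<^sub>F i in I. ?f (F i) < a" if a: "entropy_rate X < a" for a
  proof -
    have "{K. finite K \<and> K \<noteq> {} \<and> K \<subseteq> carrier G} \<noteq> {}"
      using G.one_closed by (auto intro!: exI[of _ "{\<one>\<^bsub>G\<^esub>}"])
    then obtain K where K: "finite K" "K \<noteq> {}" "K \<subseteq> carrier G" "?f K < a"
      using a cINF_less_iff[OF _ entropy_rate_bdd_below] by (auto simp: entropy_rate_def)
    have cK: "real (card K) > 0"
      using K by (simp add: card_gt_0_iff)
    have fK: "0 \<le> ln (real (card (trajectory A \<alpha> K X)))"
      using card_trajectory_pos[OF K(1,3)] by (simp add: Suc_leI)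
    \<comment> \<open>The relative growth of \<open>F i\<close> under translation by the inverse of
      k; the sum over \<open>K\<close> bounds the excess of the cover factor over 1.\<close>
    define \<delta> where "\<delta> k i = real (card ((F i #>\<^bsub>G\<^esub> inv\<^bsub>G\<^esub> k) - F i)) / real (card (F i))" for k i
    have "((\<lambda>i. (1 + (\<Sum>k\<in>K. \<delta> k i)) * ?f K) \<longlongrightarrow> (1 + (\<Sum>k\<in>K. 0)) * ?f K) I"
      using folner K(3) unfolding \<delta>_def right_folner_net_def
      by (intro tendsto_intros) auto
    hence "\<forall>\<^sub>F i in I. (1 + (\<Sum>k\<in>K. \<delta> k i)) * ?f K < a"
      using K(4) by (intro order_tendstoD) simp_all
    with ev show ?thesis
    proof eventually_elim
      case (elim i)
      have cF: "real (card (F i)) > 0"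
        using elim by (simp add: card_gt_0_iff)
      have "F i <#>\<^bsub>G\<^esub> set_inv\<^bsub>G\<^esub> K \<subseteq> F i \<union> (\<Union>k\<in>K. (F i #>\<^bsub>G\<^esub> inv\<^bsub>G\<^esub> k) - F i)"
        by (auto simp: set_mult_def SET_INV_def r_coset_def)
      hence "card (F i <#>\<^bsub>G\<^esub> set_inv\<^bsub>G\<^esub> K) \<le> card (F i \<union> (\<Union>k\<in>K. (F i #>\<^bsub>G\<^esub> inv\<^bsub>G\<^esub> k) - F i))"
        using elim K by (intro card_mono) (auto simp: r_coset_def)
      also have "\<dots> \<le> card (F i) + card (\<Union>k\<in>K. (F i #>\<^bsub>G\<^esub> inv\<^bsub>G\<^esub> k) - F i)"
        by (rule card_Un_le)
      also have "\<dots> \<le> card (F i) + (\<Sum>k\<in>K. card ((F i #>\<^bsub>G\<^esub> inv\<^bsub>G\<^esub> k) - F i))"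
        using K(1) by (intro add_left_mono card_UN_le)
      finally have "real (card (F i <#>\<^bsub>G\<^esub> set_inv\<^bsub>G\<^esub> K))
          \<le> real (card (F i) + (\<Sum>k\<in>K. card ((F i #>\<^bsub>G\<^esub> inv\<^bsub>G\<^esub> k) - F i)))"
        by (rule of_nat_mono)
      also have "\<dots> = real (card (F i)) * (1 + (\<Sum>k\<in>K. \<delta> k i))"
        using cF by (simp add: \<delta>_def distrib_left sum_distrib_left)
      finally have "real (card (F i <#>\<^bsub>G\<^esub> set_inv\<^bsub>G\<^esub> K)) * ln (real (card (trajectory A \<alpha> K X)))
          \<le> real (card (F i)) * (1 + (\<Sum>k\<in>K. \<delta> k i)) * ln (real (card (trajectory A \<alpha> K X)))"
        using fK by (rule mult_right_mono)
      hence "real (card K) * ln (real (card (trajectory A \<alpha> (F i) X)))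
          \<le> real (card (F i)) * (1 + (\<Sum>k\<in>K. \<delta> k i)) * ln (real (card (trajectory A \<alpha> K X)))"
        using ln_card_trajectory_cover[of "F i" K] elim K by linarith
      hence "?f (F i) \<le> (1 + (\<Sum>k\<in>K. \<delta> k i)) * ?f K"
        using cK cF by (simp add: field_simps)
      thus ?case
        using elim by linarith
    qed
  qed
qed

text \<open>Amenability supplies an actual net, and uniqueness of limits along it pins down the
  described value. That net is indexed by pairs, whence the use of
  \<open>entropy_limit_any_index\<close>.\<close>

lemma H_alg_eq_entropy_rate:
  assumes "amenable G"
  shows "H_alg G A \<alpha> X = entropy_rate X"
  unfolding H_alg_def
proof (rule the_equality)
  show "\<forall>(I :: 'g set filter) F. right_folner_net G I F \<longrightarrow> entropy_limit A \<alpha> X I F (entropy_rate X)"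
    using entropy_limit_entropy_rate by blast
  fix h
  assume h: "\<forall>(I :: 'g set filter) F. right_folner_net G I F \<longrightarrow> entropy_limit A \<alpha> X I F h"
  obtain E where E: "right_folner_net G (finite_subsets_at_top (carrier G) \<times>\<^sub>F sequentially) E"
    using G.amenable_folner_net[OF assms] .
  show "h = entropy_rate X"
    using entropy_limit_any_index[OF h E] entropy_limit_entropy_rate[OF E] E
    unfolding entropy_limit_def right_folner_net_def by (auto intro: tendsto_unique)
qed

text \<open>All factors lie in \<open>X\<close> itself, so an element of the trajectory is
  determined by the multiplicities of the members of \<open>X\<close>, each between 0 and
  |E|.\<close>

lemma card_trajectory_kernel_le:
  assumes E: "finite E" "E \<subseteq> action_kernel G A \<alpha>"
  shows "card (trajectory A \<alpha> E X) \<le> Suc (card E) ^ card X"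
proof -
  let ?P = "(\<lambda>m. \<Otimes>\<^bsub>A\<^esub>x\<in>X. x [^]\<^bsub>A\<^esub> m x) ` (X \<rightarrow>\<^sub>E {..card E})"
  have "trajectory A \<alpha> E X \<subseteq> ?P"
  proof
    fix v assume "v \<in> trajectory A \<alpha> E X"
    then obtain y where y: "\<forall>g\<in>E. y g \<in> \<alpha> g ` X" "v = finprod A y E"
      by (auto simp: trajectory_def)
    have "y \<in> E \<rightarrow> X"
      using y(1) E(2) X(1) by (fastforce simp: action_kernel_def)
    hence "v = (\<Otimes>\<^bsub>A\<^esub>x\<in>X. x [^]\<^bsub>A\<^esub> card {e \<in> E. y e = x})"
      using A.finprod_eq_prod_multiplicities[OF E(1) X(2,1)] y(2) by simp
    also have "\<dots> = (\<Otimes>\<^bsub>A\<^esub>x\<in>X. x [^]\<^bsub>A\<^esub> restrict (\<lambda>x. card {e \<in> E. y e = x}) X x)"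
      using X(1) by (intro A.finprod_cong') auto
    finally show "v \<in> ?P"
      using E(1) by (intro image_eqI) (auto intro!: card_mono)
  qed
  moreover have fin: "finite (X \<rightarrow>\<^sub>E {..card E})"
    using X by (intro finite_PiE) auto
  ultimately have "card (trajectory A \<alpha> E X) \<le> card ?P"
    by (intro card_mono) auto
  also have "\<dots> \<le> card (X \<rightarrow>\<^sub>E {..card E})"
    using fin by (rule card_image_le)
  also have "\<dots> = Suc (card E) ^ card X"
    using X by (simp add: card_PiE)
  finally show ?thesis .
qed

lemma entropy_rate_infinite_kernel:
  assumes N: "infinite N" "N \<subseteq> action_kernel G A \<alpha>"
  shows "entropy_rate X = 0"
proof -
  \<comment> \<open>The factor 2 absorbs n + 1 \<le> 2n, which turns the bound into a multiple of ln
    m / m at m = n + 1.\<close>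
  have "entropy_rate X \<le> 2 * real (card X) * (ln (real (Suc n)) / real (Suc n))" if n: "n > 0" for n
  proof -
    obtain E where E: "E \<subseteq> N" "finite E" "card E = n"
      using infinite_arbitrarily_large[OF N(1)] by blast
    have EG: "E \<subseteq> carrier G"
      using E N by (auto simp: action_kernel_def)
    have "E \<noteq> {}"
      using E n by force
    hence "entropy_rate X \<le> ln (real (card (trajectory A \<alpha> E X))) / real n"
      using entropy_rate_le[of E] E EG by simp
    also have "\<dots> \<le> ln (real (Suc n ^ card X)) / real n"
    proof (intro divide_right_mono)
      show "ln (real (card (trajectory A \<alpha> E X))) \<le> ln (real (Suc n ^ card X))"
        using card_trajectory_kernel_le[of E] card_trajectory_pos[OF E(2) EG] E N
        by (subst ln_le_cancel_iff) (auto simp del: of_nat_power)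
    qed simp
    also have "\<dots> = real (card X) * (ln (real (Suc n)) / real n)"
      by (simp add: ln_realpow)
    also have "\<dots> \<le> real (card X) * (2 * (ln (real (Suc n)) / real (Suc n)))"
    proof (intro mult_left_mono)
      have "ln (real (Suc n)) * real (Suc n) \<le> ln (real (Suc n)) * (2 * real n)"
        using n by (intro mult_left_mono) auto
      thus "ln (real (Suc n)) / real n \<le> 2 * (ln (real (Suc n)) / real (Suc n))"
        using n by (simp add: field_simps)
    qed simp
    finally show ?thesis by (simp only: mult.assoc mult.left_commute)
  qed
  hence "\<forall>\<^sub>F n in sequentially. entropy_rate X \<le> 2 * real (card X) * (ln (real (Suc n)) / real (Suc n))"
    by (intro eventually_sequentiallyI[of 1]) simp
  moreover have "(\<lambda>n. 2 * real (card X) * (ln (real (Suc n)) / real (Suc n))) \<longlonglongrightarrow> 2 * real (card X) * 0"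
    by (intro tendsto_mult_left LIMSEQ_Suc
        filterlim_compose[OF ln_x_over_x_tendsto_0 filterlim_real_sequentially])
  ultimately have "entropy_rate X \<le> 2 * real (card X) * 0"
    by (intro tendsto_lowerbound) auto
  thus ?thesis
    using entropy_rate_nonneg by simp
qed

end

end

section \<open>Actions with a normal subgroup in the kernel\<close>

text \<open>Disjointness of the blocks allows choices made separately on each block to be glued into
  one choice on the union.\<close>

lemma (in comm_monoid) set_prod_Union:
  assumes "finite S" and fin: "\<And>C. C \<in> S \<Longrightarrow> finite C" and disj: "pairwise disjnt S"
    and B: "\<And>i. i \<in> \<Union>S \<Longrightarrow> B i \<subseteq> carrier G"
  shows "set_prod G B (\<Union>S) = set_prod G (set_prod G B) S"
proof -
  have split: "finprod G y (\<Union>S) = finprod G (finprod G y) S" if "\<forall>i\<in>\<Union>S. y i \<in> B i" for y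
    using assms that by (intro finprod_Union_disjoint) blast+
  show ?thesis
  proof (intro equalityI subsetI)
    fix v assume "v \<in> set_prod G B (\<Union>S)"
    then obtain y where y: "\<forall>i\<in>\<Union>S. y i \<in> B i" "v = finprod G y (\<Union>S)"
      unfolding set_prod_def by blast
    have "\<forall>C\<in>S. finprod G y C \<in> set_prod G B C"
      using y(1) unfolding set_prod_def by blast
    thus "v \<in> set_prod G (set_prod G B) S"
      using y(2) split[OF y(1)] unfolding set_prod_def[of G "set_prod G B"] by blast
  next
    fix v assume "v \<in> set_prod G (set_prod G B) S"
    then obtain z where z: "\<forall>C\<in>S. z C \<in> set_prod G B C" "v = finprod G z S"
      unfolding set_prod_def[of G "set_prod G B"] by blast
    have "\<forall>C\<in>S. \<exists>y. (\<forall>i\<in>C. y i \<in> B i) \<and> z C = finprod G y C"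
      using z(1) unfolding set_prod_def by blast
    then obtain Y where Y: "\<forall>C\<in>S. (\<forall>i\<in>C. Y C i \<in> B i) \<and> z C = finprod G (Y C) C"
      by (rule bchoice[THEN exE])
    \<comment> \<open>The description picks the unique block containing i, and the value is the
      choice made on that block.\<close>
    define y where "y i = Y (THE C. C \<in> S \<and> i \<in> C) i" for i
    have y: "y i = Y C i" if "C \<in> S" "i \<in> C" for C i
    proof -
      have "(THE C. C \<in> S \<and> i \<in> C) = C"
        using that disj by (intro the_equality) (auto simp: pairwise_def disjnt_def)
      thus ?thesis
        by (simp add: y_def)
    qed
    have yB: "\<forall>i\<in>\<Union>S. y i \<in> B i"
      using y Y by auto
    have C: "finprod G y C = z C" if "C \<in> S" for C
    proof -
      have "finprod G y C = finprod G (Y C) C"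
        using y[OF that] Y B that by (intro finprod_cong') blast+
      thus ?thesis
        using Y that by simp
    qed
    have "z \<in> S \<rightarrow> carrier G"
      using z(1) set_prod_subset_carrier[of _ B] B by blast
    hence "finprod G (finprod G y) S = finprod G z S"
      using C by (intro finprod_cong') auto
    hence "v = finprod G y (\<Union>S)"
      using z(2) split[OF yB] by simp
    thus "v \<in> set_prod G B (\<Union>S)"
      using yB unfolding set_prod_def by blast
  qed
qed

lemma set_prod_cong:
  assumes "\<And>i. i \<in> I \<Longrightarrow> B i = C i"
  shows "set_prod G B I = set_prod G C I"
  unfolding set_prod_def using assms by auto

lemma (in comm_group) finprod_subgroup_closed:
  assumes "subgroup H G" "y \<in> F \<rightarrow> H"
  shows "finprod G y F \<in> H"
  using assms(2)
proof (induction F rule: infinite_finite_induct)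
  case (insert i F)
  interpret subgroup H G by fact
  have "finprod G y (insert i F) = y i \<otimes> finprod G y F"
    using insert by (intro finprod_insert) (auto intro!: mem_carrier)
  thus ?case
    using insert by auto
qed (use subgroup.one_closed[OF assms(1)] in auto)

section \<open>Cosets, invariant means and Foelner nets for the quotient group\<close>

context normal
begin

lemma carrier_Mod_imp_subset: "C \<in> carrier (G Mod H) \<Longrightarrow> C \<subseteq> carrier G"
  by (auto simp: carrier_FactGroup r_coset_def)

text \<open>The quotient consists of right cosets, whereas \<open>trajectory_l_coset\<close> speaks
  of left translates; normality reconciles the two.\<close>

lemma carrier_Mod_eq_l_coset:
  assumes "C \<in> carrier (G Mod H)" "g \<in> C"
  shows "C = g <# H"
proof -
  obtain x where x: "x \<in> carrier G" "C = H #> x"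
    using assms(1) by (auto simp: carrier_FactGroup)
  have g: "g \<in> carrier G"
    using assms carrier_Mod_imp_subset by blast
  have "C = H #> g"
    using repr_independence[of g H x] x assms(2) subgroup_axioms by simp
  thus ?thesis
    using coset_eq g by simp
qed

lemma carrier_Mod_disjnt: "pairwise disjnt (carrier (G Mod H))"
  using rcos_disjoint[OF subgroup_axioms] by (simp add: FactGroup_def)

lemma Union_carrier_Mod: "\<Union>(carrier (G Mod H)) = carrier G"
  using rcosets_part_G[OF subgroup_axioms] by (simp add: FactGroup_def)

lemma carrier_Mod_nonempty: "C \<in> carrier (G Mod H) \<Longrightarrow> C \<noteq> {}"
  using rcosets_non_empty by (simp add: FactGroup_def)

lemma card_pos: "finite H \<Longrightarrow> card H > 0"
  using subgroup.one_closed[OF subgroup_axioms] by (metis card_gt_0_iff empty_iff)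

lemma card_carrier_Mod:
  assumes "C \<in> carrier (G Mod H)"
  shows "card C = card H"
proof -
  obtain x where x: "x \<in> carrier G" "C = H #> x"
    using assms by (auto simp: carrier_FactGroup)
  have "C = (\<lambda>h. h \<otimes> x) ` H"
    using x by (auto simp: r_coset_def)
  moreover have "inj_on (\<lambda>h. h \<otimes> x) H"
    using x(1) by (intro inj_onI) (simp add: mem_carrier)
  ultimately show ?thesis
    by (simp add: card_image)
qed

lemma finite_carrier_Mod:
  assumes "finite H" "C \<in> carrier (G Mod H)"
  shows "finite C"
  using assms by (auto simp: carrier_FactGroup r_coset_def)

lemma card_Union_carrier_Mod:
  assumes "finite H" "S \<subseteq> carrier (G Mod H)"
  shows "card (\<Union>S) = card H * card S"
proof -
  have "card (\<Union>S) = (\<Sum>C\<in>S. card C)"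
    using assms finite_carrier_Mod carrier_Mod_disjnt
    by (intro card_Union_disjoint) (auto intro: pairwise_subset)
  also have "\<dots> = (\<Sum>C\<in>S. card H)"
    using assms(2) card_carrier_Mod by (intro sum.cong) auto
  finally show ?thesis by simp
qed

lemma Union_carrier_Mod_Diff:
  assumes "S \<subseteq> carrier (G Mod H)" "T \<subseteq> carrier (G Mod H)"
  shows "\<Union>(S - T) = \<Union>S - \<Union>T"
proof -
  have "C = D" if "C \<in> S" "D \<in> T" "x \<in> C" "x \<in> D" for C D x
    using that assms carrier_Mod_disjnt unfolding pairwise_def disjnt_def by blast
  thus ?thesis
    by blast
qed

text \<open>The union of a set of cosets is its preimage under the quotient map. Normality moves
  \<open>H\<close> past g, so translation upstairs matches translation downstairs.\<close>

lemma Union_Mod_l_coset: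
  assumes "S \<subseteq> carrier (G Mod H)" "g \<in> carrier G"
  shows "\<Union>((H #> g) <#\<^bsub>G Mod H\<^esub> S) = g <# \<Union>S"
proof -
  have "(H #> g) <#> D = g <# D" if D: "D \<in> S" for D
  proof -
    obtain d where d: "d \<in> carrier G" "D = H #> d"
      using subsetD[OF assms(1) D] by (auto simp: carrier_FactGroup)
    have "g <# (H #> d) = (g <# H) #> d"
      using assms(2) d(1) subset by (rule coset_assoc)
    thus ?thesis
      using d assms(2) rcos_sum coset_eq coset_mult_assoc[OF subset] by simp
  qed
  hence "(H #> g) <#\<^bsub>G Mod H\<^esub> S = (\<lambda>D. g <# D) ` S"
    by (auto simp: l_coset_def[of "G Mod H"])
  thus ?thesis
    by (auto simp: l_coset_def)
qed

lemma Union_Mod_r_coset: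
  assumes "S \<subseteq> carrier (G Mod H)" "g \<in> carrier G"
  shows "\<Union>(S #>\<^bsub>G Mod H\<^esub> (H #> g)) = \<Union>S #> g"
proof -
  have "D <#> (H #> g) = D #> g" if D: "D \<in> S" for D
  proof -
    obtain d where d: "d \<in> carrier G" "D = H #> d"
      using subsetD[OF assms(1) D] by (auto simp: carrier_FactGroup)
    thus ?thesis
      using assms(2) rcos_sum coset_mult_assoc[OF subset] by simp
  qed
  hence "S #>\<^bsub>G Mod H\<^esub> (H #> g) = (\<lambda>D. D #> g) ` S"
    by (auto simp: r_coset_def[of "G Mod H"])
  thus ?thesis
    by (auto simp: r_coset_def)
qed

text \<open>The mean is pushed forward along the quotient map: a set of cosets is measured by its
  preimage.\<close>

lemma amenable_Mod:
  assumes "amenable G"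
  shows "amenable (G Mod H)"
proof -
  obtain \<mu> :: "'a set \<Rightarrow> real" where \<mu>:
    "(\<forall>S. S \<subseteq> carrier G \<longrightarrow> 0 \<le> \<mu> S) \<and> \<mu> (carrier G) = 1 \<and>
     (\<forall>S T. S \<subseteq> carrier G \<longrightarrow> T \<subseteq> carrier G \<longrightarrow> S \<inter> T = {} \<longrightarrow> \<mu> (S \<union> T) = \<mu> S + \<mu> T) \<and>
     (\<forall>g\<in>carrier G. \<forall>S. S \<subseteq> carrier G \<longrightarrow> \<mu> (g <# S) = \<mu> S)"
    using assms unfolding amenable_def by (rule exE)
  let ?Q = "carrier (G Mod H)"
  have sub: "\<Union>S \<subseteq> carrier G" if "S \<subseteq> ?Q" for S
    using that Union_carrier_Mod by blast
  have total: "\<mu> (\<Union>?Q) = 1"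
    using \<mu> unfolding Union_carrier_Mod by simp
  have add: "\<mu> (\<Union>(S \<union> T)) = \<mu> (\<Union>S) + \<mu> (\<Union>T)" if ST: "S \<subseteq> ?Q" "T \<subseteq> ?Q" "S \<inter> T = {}" for S T
  proof -
    have "\<Union>S \<inter> \<Union>T = {}"
      using Union_carrier_Mod_Diff[OF ST(1,2)] ST(3) by (metis Diff_disjoint Diff_triv inf_commute)
    thus ?thesis
      using \<mu> sub[OF ST(1)] sub[OF ST(2)] by (simp add: Union_Un_distrib)
  qed
  have invariant: "\<mu> (\<Union>(C <#\<^bsub>G Mod H\<^esub> S)) = \<mu> (\<Union>S)" if C: "C \<in> ?Q" and S: "S \<subseteq> ?Q" for C S
  proof -
    obtain g where g: "g \<in> carrier G" "C = H #> g"
      using C by (auto simp: carrier_FactGroup)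
    show ?thesis
      using Union_Mod_l_coset[OF S g(1)] \<mu> sub[OF S] g by simp
  qed
  show ?thesis
    unfolding amenable_def
    by (intro exI[of _ "\<lambda>S. \<mu> (\<Union>S)"] conjI allI impI ballI total add invariant) (use \<mu> sub in auto)
qed

text \<open>Taking preimages multiplies numerator and denominator of the Foelner quotient by |H|, so
  the quotient does not change.\<close>

lemma right_folner_net_Union:
  assumes "finite H" and folner: "right_folner_net (G Mod H) I E"
  shows "right_folner_net G I (\<lambda>i. \<Union>(E i))"
  unfolding right_folner_net_def
proof (intro conjI ballI)
  have ev: "\<forall>\<^sub>F i in I. finite (E i) \<and> E i \<noteq> {} \<and> E i \<subseteq> carrier (G Mod H)"
    using folner by (simp add: right_folner_net_def)
  show "I \<noteq> bot"
    using folner by (simp add: right_folner_net_def)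
  show "\<forall>\<^sub>F i in I. finite (\<Union>(E i)) \<and> \<Union>(E i) \<noteq> {} \<and> \<Union>(E i) \<subseteq> carrier G"
    using ev
  proof eventually_elim
    case (elim i)
    hence "finite (\<Union>(E i))"
      using finite_carrier_Mod[OF assms(1)] by blast
    moreover have "\<Union>(E i) \<noteq> {}"
      using elim carrier_Mod_nonempty by blast
    moreover have "\<Union>(E i) \<subseteq> carrier G"
      using elim carrier_Mod_imp_subset by blast
    ultimately show ?case by blast
  qed
  fix g assume g: "g \<in> carrier G"
  let ?C = "H #> g"
  have C: "?C \<in> carrier (G Mod H)"
    using g by (auto simp: carrier_FactGroup)
  have "((\<lambda>i. real (card ((E i #>\<^bsub>G Mod H\<^esub> ?C) - E i)) / real (card (E i))) \<longlongrightarrow> 0) I"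
    using folner C unfolding right_folner_net_def by blast
  moreover have "\<forall>\<^sub>F i in I. real (card ((E i #>\<^bsub>G Mod H\<^esub> ?C) - E i)) / real (card (E i))
      = real (card ((\<Union>(E i) #> g) - \<Union>(E i))) / real (card (\<Union>(E i)))"
    using ev
  proof eventually_elim
    case (elim i)
    interpret Q: group "G Mod H"
      by (rule factorgroup_is_group)
    have E: "E i \<subseteq> carrier (G Mod H)" and EC: "E i #>\<^bsub>G Mod H\<^esub> ?C \<subseteq> carrier (G Mod H)"
      using elim C Q.r_coset_subset_G by auto
    have "(\<Union>(E i) #> g) - \<Union>(E i) = \<Union>((E i #>\<^bsub>G Mod H\<^esub> ?C) - E i)"
      unfolding Union_carrier_Mod_Diff[OF EC E] Union_Mod_r_coset[OF E g] ..
    hence "card ((\<Union>(E i) #> g) - \<Union>(E i)) = card H * card ((E i #>\<^bsub>G Mod H\<^esub> ?C) - E i)"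
      using EC card_Union_carrier_Mod[OF assms(1), of "(E i #>\<^bsub>G Mod H\<^esub> ?C) - E i"] by auto
    moreover have "card (\<Union>(E i)) = card H * card (E i)"
      using card_Union_carrier_Mod[OF assms(1) E] .
    moreover have "card H > 0"
      using card_pos[OF assms(1)] .
    ultimately show ?case by simp
  qed
  ultimately show "((\<lambda>i. real (card ((\<Union>(E i) #> g) - \<Union>(E i))) / real (card (\<Union>(E i)))) \<longlongrightarrow> 0) I"
    by (rule Lim_transform_eventually)
qed

end

section \<open>Comparison with the quotient action for a finite subgroup of the kernel\<close>

locale finite_kernel_action = endo_action +
  fixes N :: "'a set"
  assumes normal: "N \<lhd> G" and kernel: "N \<subseteq> action_kernel G A \<alpha>" and finite_N: "finite N"
begin

sublocale N: normal N G
  by (rule normal)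

sublocale Q: endo_action "G Mod N" A "quotient_action \<alpha>"
  by (intro endo_action.intro endo_action_axioms.intro N.factorgroup_is_group A.comm_group_axioms
      left_action_quotient normal action kernel)

lemma some_in_Mod:
  assumes "C \<in> carrier (G Mod N)"
  shows "(SOME g. g \<in> C) \<in> C"
  using N.carrier_Mod_nonempty[OF assms] by (simp add: some_in_eq)

text \<open>The representative chosen in \<open>quotient_action\<close> also writes the coset as a
  left translate of \<open>N\<close>.\<close>

lemma trajectory_coset:
  assumes "C \<in> carrier (G Mod N)" "X \<subseteq> carrier A"
  shows "trajectory A \<alpha> C X = quotient_action \<alpha> C ` trajectory A \<alpha> N X"
proof -
  let ?g = "SOME g. g \<in> C"
  have "C = ?g <#\<^bsub>G\<^esub> N"
    using N.carrier_Mod_eq_l_coset[OF assms(1) some_in_Mod[OF assms(1)]] .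
  moreover have "?g \<in> carrier G"
    using some_in_Mod[OF assms(1)] N.carrier_Mod_imp_subset[OF assms(1)] by blast
  ultimately show ?thesis
    using trajectory_l_coset[OF _ N.subset assms(2), of ?g] by (simp add: quotient_action_def)
qed

text \<open>Grouping the factors coset by coset leaves, over each coset, the image of the trajectory
  of \<open>N\<close> under the quotient action.\<close>

lemma trajectory_Union_cosets:
  assumes S: "S \<subseteq> carrier (G Mod N)" "finite S" and X: "X \<subseteq> carrier A"
  shows "trajectory A \<alpha> (\<Union>S) X = trajectory A (quotient_action \<alpha>) S (trajectory A \<alpha> N X)"
proof -
  have "set_prod A (\<lambda>g. \<alpha> g ` X) (\<Union>S) = set_prod A (set_prod A (\<lambda>g. \<alpha> g ` X)) S"
  proof (rule A.set_prod_Union)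
    show "pairwise disjnt S"
      using N.carrier_Mod_disjnt S(1) by (rule pairwise_subset)
    show "\<alpha> g ` X \<subseteq> carrier A" if "g \<in> \<Union>S" for g
      using that S N.carrier_Mod_imp_subset X by (intro action_image) blast+
  qed (use S N.finite_carrier_Mod[OF finite_N] in auto)
  also have "\<dots> = set_prod A (\<lambda>C. quotient_action \<alpha> C ` trajectory A \<alpha> N X) S"
    using S trajectory_coset[OF _ X] by (intro set_prod_cong) (auto simp: trajectory_eq_set_prod)
  finally show ?thesis
    by (simp add: trajectory_eq_set_prod)
qed

text \<open>Rewriting a quotient trajectory over chosen representatives places it in the original
  action, where monotonicity in the index set is available.\<close>

lemma trajectory_transversal:
  assumes S: "S \<subseteq> carrier (G Mod N)" and X: "X \<subseteq> carrier A"
  shows "trajectory A (quotient_action \<alpha>) S X = trajectory A \<alpha> ((\<lambda>C. SOME g. g \<in> C) ` S) X"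
proof -
  let ?r = "\<lambda>C :: 'a set. SOME g. g \<in> C"
  have inj: "inj_on ?r S"
  proof (rule inj_onI)
    fix C D assume "C \<in> S" "D \<in> S" "?r C = ?r D"
    thus "C = D"
      using some_in_Mod[of C] some_in_Mod[of D] S N.carrier_Mod_disjnt
      unfolding pairwise_def disjnt_def by (metis disjoint_iff subsetD)
  qed
  have r: "?r ` S \<subseteq> carrier G"
    using some_in_Mod S N.carrier_Mod_imp_subset by blast
  have reindex: "(\<Otimes>\<^bsub>A\<^esub>g\<in>?r ` S. \<alpha> g (x g)) = (\<Otimes>\<^bsub>A\<^esub>C\<in>S. quotient_action \<alpha> C (x (?r C)))"
    if "x \<in> ?r ` S \<rightarrow> X" for x
    unfolding quotient_action_def
    using that r X by (intro A.finprod_reindex inj) (auto intro!: action_closed)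
  show ?thesis
    unfolding trajectory_param[OF r X] Q.trajectory_param[OF S X]
  proof (intro equalityI subsetI)
    fix v assume "v \<in> {(\<Otimes>\<^bsub>A\<^esub>C\<in>S. quotient_action \<alpha> C (x C)) | x. x \<in> S \<rightarrow> X}"
    then obtain x where x: "x \<in> S \<rightarrow> X" "v = (\<Otimes>\<^bsub>A\<^esub>C\<in>S. quotient_action \<alpha> C (x C))"
      by blast
    define z where "z g = x (the_inv_into S ?r g)" for g
    have zr: "z (?r C) = x C" if "C \<in> S" for C
      using the_inv_into_f_f[OF inj that] by (simp add: z_def)
    hence z: "z \<in> ?r ` S \<rightarrow> X"
      using x(1) by auto
    have "v = (\<Otimes>\<^bsub>A\<^esub>C\<in>S. quotient_action \<alpha> C (z (?r C)))"
      unfolding x(2) using zr x(1) S X by (intro A.finprod_cong') (auto intro!: Q.action_closed)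
    hence "v = (\<Otimes>\<^bsub>A\<^esub>g\<in>?r ` S. \<alpha> g (z g))"
      using reindex[OF z] by simp
    thus "v \<in> {(\<Otimes>\<^bsub>A\<^esub>g\<in>?r ` S. \<alpha> g (x g)) | x. x \<in> ?r ` S \<rightarrow> X}"
      using z by blast
  next
    fix v assume "v \<in> {(\<Otimes>\<^bsub>A\<^esub>g\<in>?r ` S. \<alpha> g (x g)) | x. x \<in> ?r ` S \<rightarrow> X}"
    then obtain x where x: "x \<in> ?r ` S \<rightarrow> X" "v = (\<Otimes>\<^bsub>A\<^esub>g\<in>?r ` S. \<alpha> g (x g))"
      by blast
    have "(\<lambda>C. x (?r C)) \<in> S \<rightarrow> X"
      using x(1) by auto
    thus "v \<in> {(\<Otimes>\<^bsub>A\<^esub>C\<in>S. quotient_action \<alpha> C (x C)) | x. x \<in> S \<rightarrow> X}"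
      using x(2) reindex[OF x(1)] by (intro CollectI exI[of _ "\<lambda>C. x (?r C)"]) simp
  qed
qed

lemma trajectory_kernel_finite_subset:
  assumes "X \<subseteq> carrier A" "finite X" "X \<noteq> {}"
  shows "trajectory A \<alpha> N X \<subseteq> carrier A" "finite (trajectory A \<alpha> N X)" "trajectory A \<alpha> N X \<noteq> {}"
  using trajectory_subset_carrier[OF N.subset assms(1)] finite_trajectory[OF assms finite_N N.subset]
    trajectory_nonempty[OF assms] by simp_all

text \<open>\<open>X\<close> need not be contained in its trajectory over \<open>N\<close>, so sizes
  are compared instead: representatives of the cosets in \<open>K\<close> form a subset of
  \<Union>K, and the trajectory over \<Union>K is the quotient trajectory of the enlarged
  set.\<close>

lemma entropy_rate_quotient_mono:
  assumes X: "X \<subseteq> carrier A" "finite X" "X \<noteq> {}"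
  shows "Q.entropy_rate X \<le> Q.entropy_rate (trajectory A \<alpha> N X)"
  unfolding Q.entropy_rate_def[of "trajectory A \<alpha> N X"]
proof (rule cINF_greatest)
  show "{K. finite K \<and> K \<noteq> {} \<and> K \<subseteq> carrier (G Mod N)} \<noteq> {}"
    using Q.G.one_closed by (auto intro!: exI[of _ "{\<one>\<^bsub>G Mod N\<^esub>}"] simp del: one_FactGroup)
  fix K assume K: "K \<in> {K. finite K \<and> K \<noteq> {} \<and> K \<subseteq> carrier (G Mod N)}"
  hence KQ: "K \<subseteq> carrier (G Mod N)" and "finite K"
    by auto
  have "(\<lambda>C. SOME g. g \<in> C) ` K \<subseteq> \<Union>K"
    using KQ some_in_Mod by blast
  moreover have "finite (\<Union>K)" "\<Union>K \<subseteq> carrier G"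
    using KQ \<open>finite K\<close> N.finite_carrier_Mod[OF finite_N] N.carrier_Mod_imp_subset by blast+
  ultimately have "card (trajectory A (quotient_action \<alpha>) K X) \<le> card (trajectory A \<alpha> (\<Union>K) X)"
    unfolding trajectory_transversal[OF KQ X(1)] by (rule card_trajectory_mono[OF X])
  also have "\<dots> = card (trajectory A (quotient_action \<alpha>) K (trajectory A \<alpha> N X))"
    using K trajectory_Union_cosets[of K X] X by simp
  finally have le: "card (trajectory A (quotient_action \<alpha>) K X)
      \<le> card (trajectory A (quotient_action \<alpha>) K (trajectory A \<alpha> N X))" .
  have "Q.entropy_rate X \<le> ln (real (card (trajectory A (quotient_action \<alpha>) K X))) / real (card K)"
    using K by (intro Q.entropy_rate_le X) auto
  also have "\<dots> \<le> ln (real (card (trajectory A (quotient_action \<alpha>) K (trajectory A \<alpha> N X)))) / real (card K)"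
    using le Q.card_trajectory_pos[OF X, of K] K by (intro divide_right_mono) simp_all
  finally show "Q.entropy_rate X
      \<le> ln (real (card (trajectory A (quotient_action \<alpha>) K (trajectory A \<alpha> N X)))) / real (card K)" .
qed

text \<open>Both sides are limits along the preimages of one Foelner net of the quotient: the
  trajectories coincide, and the index sets differ in size by the factor |N|.\<close>

lemma entropy_rate_eq_quotient:
  assumes "amenable G" and X: "X \<subseteq> carrier A" "finite X" "X \<noteq> {}"
  shows "entropy_rate X = Q.entropy_rate (trajectory A \<alpha> N X) / real (card N)"
proof -
  let ?Y = "trajectory A \<alpha> N X" and ?I = "finite_subsets_at_top (carrier (G Mod N)) \<times>\<^sub>F sequentially"
  note Y = trajectory_kernel_finite_subset[OF X]
  obtain E where E: "right_folner_net (G Mod N) ?I E"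
    using Q.G.amenable_folner_net[OF N.amenable_Mod[OF assms(1)]] .
  have "entropy_limit A \<alpha> X ?I (\<lambda>i. \<Union>(E i)) (entropy_rate X)"
    using entropy_limit_entropy_rate[OF X N.right_folner_net_Union[OF finite_N E]] .
  moreover have "entropy_limit A \<alpha> X ?I (\<lambda>i. \<Union>(E i)) (Q.entropy_rate ?Y / real (card N))"
    unfolding entropy_limit_def
  proof (rule Lim_transform_eventually)
    show "((\<lambda>i. ln (real (card (trajectory A (quotient_action \<alpha>) (E i) ?Y))) / real (card (E i)) / real (card N))
        \<longlongrightarrow> Q.entropy_rate ?Y / real (card N)) ?I"
      using Q.entropy_limit_entropy_rate[OF Y E] unfolding entropy_limit_def
      by (rule tendsto_divide[OF _ tendsto_const]) (use N.card_pos[OF finite_N] in simp)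
    have "\<forall>\<^sub>F i in ?I. finite (E i) \<and> E i \<noteq> {} \<and> E i \<subseteq> carrier (G Mod N)"
      using E by (simp add: right_folner_net_def)
    thus "\<forall>\<^sub>F i in ?I. ln (real (card (trajectory A (quotient_action \<alpha>) (E i) ?Y))) / real (card (E i)) / real (card N)
        = ln (real (card (trajectory A \<alpha> (\<Union>(E i)) X))) / real (card (\<Union>(E i)))"
    proof eventually_elim
      case (elim i)
      thus ?case
        using trajectory_Union_cosets[of "E i" X] X N.card_Union_carrier_Mod[OF finite_N, of "E i"]
        by (simp add: mult.commute)
    qed
  qed
  ultimately show ?thesis
    using E unfolding entropy_limit_def right_folner_net_def by (auto intro: tendsto_unique)
qed

text \<open>Stated for any family closed under passing to the trajectory over \<open>N\<close>, so
  that both entropies are instances. Closure gives one inequality,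
  \<open>entropy_rate_quotient_mono\<close> the other.\<close>

lemma SUP_H_alg_eq_quotient:
  assumes "amenable G"
    and \<X>: "\<And>X. X \<in> \<X> \<Longrightarrow> X \<subseteq> carrier A \<and> finite X \<and> X \<noteq> {}"
    and closed: "\<And>X. X \<in> \<X> \<Longrightarrow> trajectory A \<alpha> N X \<in> \<X>"
  shows "(SUP X\<in>\<X>. ereal (H_alg G A \<alpha> X))
    = (SUP X\<in>\<X>. ereal (H_alg (G Mod N) A (quotient_action \<alpha>) X)) / ereal (real (card N))"
proof -
  let ?n = "ereal (real (card N))"
  have n: "real (card N) > 0"
    using N.card_pos[OF finite_N] by simp
  have H: "H_alg G A \<alpha> X = Q.entropy_rate (trajectory A \<alpha> N X) / real (card N)" if "X \<in> \<X>" for X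
    using H_alg_eq_entropy_rate[OF _ _ _ assms(1)] entropy_rate_eq_quotient[OF assms(1)] \<X>[OF that] by simp
  have HQ: "H_alg (G Mod N) A (quotient_action \<alpha>) X = Q.entropy_rate X" if "X \<in> \<X>" for X
    using Q.H_alg_eq_entropy_rate[OF _ _ _ N.amenable_Mod[OF assms(1)]] \<X>[OF that] by simp
  show ?thesis
  proof (rule antisym)
    show "(SUP X\<in>\<X>. ereal (H_alg G A \<alpha> X))
      \<le> (SUP X\<in>\<X>. ereal (H_alg (G Mod N) A (quotient_action \<alpha>) X)) / ?n"
    proof (rule SUP_least)
      fix X assume X: "X \<in> \<X>"
      have "ereal (H_alg G A \<alpha> X)
          = ereal (H_alg (G Mod N) A (quotient_action \<alpha>) (trajectory A \<alpha> N X)) / ?n"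
        using H[OF X] HQ[OF closed[OF X]] n by simp
      also have "\<dots> \<le> (SUP X\<in>\<X>. ereal (H_alg (G Mod N) A (quotient_action \<alpha>) X)) / ?n"
        using closed[OF X] n by (intro ereal_divide_right_mono SUP_upper) auto
      finally show "ereal (H_alg G A \<alpha> X)
          \<le> (SUP X\<in>\<X>. ereal (H_alg (G Mod N) A (quotient_action \<alpha>) X)) / ?n" .
    qed
    have "(SUP X\<in>\<X>. ereal (H_alg (G Mod N) A (quotient_action \<alpha>) X))
        \<le> ?n * (SUP X\<in>\<X>. ereal (H_alg G A \<alpha> X))"
    proof (rule SUP_least)
      fix X assume X: "X \<in> \<X>"
      have "H_alg (G Mod N) A (quotient_action \<alpha>) X / real (card N) \<le> H_alg G A \<alpha> X"
        unfolding H[OF X] HQ[OF X] using \<X>[OF X] by (intro divide_right_mono entropy_rate_quotient_mono) auto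
      hence "ereal (H_alg (G Mod N) A (quotient_action \<alpha>) X) / ?n \<le> ereal (H_alg G A \<alpha> X)"
        using n by simp
      also have "\<dots> \<le> (SUP X\<in>\<X>. ereal (H_alg G A \<alpha> X))"
        using X by (rule SUP_upper)
      finally show "ereal (H_alg (G Mod N) A (quotient_action \<alpha>) X) \<le> ?n * (SUP X\<in>\<X>. ereal (H_alg G A \<alpha> X))"
        using n by (subst (asm) ereal_divide_le_pos) auto
    qed
    thus "(SUP X\<in>\<X>. ereal (H_alg (G Mod N) A (quotient_action \<alpha>) X)) / ?n
        \<le> (SUP X\<in>\<X>. ereal (H_alg G A \<alpha> X))"
      using n by (subst ereal_divide_le_pos) auto
  qed
qed

text \<open>Products of elements of \<open>X\<close> stay in \<open>X\<close> because
  \<open>N\<close> acts trivially, and monotonicity from the unit to \<open>N\<close> shows that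
  none are lost. This is the closure needed for \<open>ent\<close>.\<close>

lemma trajectory_kernel_subgroup:
  assumes X: "subgroup X A" "finite X"
  shows "trajectory A \<alpha> N X = X"
proof -
  note sub = subgroup.subset[OF X(1)]
  have ne: "X \<noteq> {}"
    using subgroup.one_closed[OF X(1)] by auto
  have triv: "\<alpha> g ` X = X" if "g \<in> N" for g
    using that kernel sub by (force simp: action_kernel_def)
  have "trajectory A \<alpha> N X \<subseteq> X"
    unfolding trajectory_def using triv by (auto intro!: A.finprod_subgroup_closed[OF X(1)])
  moreover have "card X \<le> card (trajectory A \<alpha> N X)"
  proof -
    have "X \<subseteq> trajectory A \<alpha> {\<one>\<^bsub>G\<^esub>} X"
    proof
      fix x assume x: "x \<in> X"
      have "x = (\<Otimes>\<^bsub>A\<^esub>g\<in>{\<one>\<^bsub>G\<^esub>}. x)"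
        using x sub by (simp add: A.finprod_const subset_iff)
      moreover have "x \<in> \<alpha> \<one>\<^bsub>G\<^esub> ` X"
        using triv[OF subgroup.one_closed[OF N.subgroup_axioms]] x by simp
      ultimately show "x \<in> trajectory A \<alpha> {\<one>\<^bsub>G\<^esub>} X"
        unfolding trajectory_def by (intro CollectI exI[of _ "\<lambda>_. x"]) simp
    qed
    hence "card X \<le> card (trajectory A \<alpha> {\<one>\<^bsub>G\<^esub>} X)"
      by (intro card_mono finite_trajectory[OF sub X(2) ne]) auto
    also have "\<dots> \<le> card (trajectory A \<alpha> N X)"
      using card_trajectory_mono[OF sub X(2) ne, of "{\<one>\<^bsub>G\<^esub>}" N]
        finite_N subgroup.one_closed[OF N.subgroup_axioms] N.subset by auto
    finally show ?thesis .
  qed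
  ultimately show ?thesis
    using X(2) by (intro card_seteq) auto
qed

end

section \<open>The finite and the infinite case\<close>

theorem theorem5p24:
  fixes G :: "('g, 'm) monoid_scheme"
    and A :: "('a, 'n) monoid_scheme"
    and \<alpha> :: "'g \<Rightarrow> 'a \<Rightarrow> 'a"
    and N :: "'g set"
  assumes "group G" and "amenable G"
    and "comm_group A"
    and "left_action G A \<alpha>"
    and "N \<lhd> G" and "N \<subseteq> action_kernel G A \<alpha>"
  shows "h_alg G A \<alpha> =
           (if infinite N then 0
            else h_alg (G Mod N) A (quotient_action \<alpha>) / ereal (real (card N))) \<and>
         ent G A \<alpha> =
           (if infinite N then 0
            else ent (G Mod N) A (quotient_action \<alpha>) / ereal (real (card N)))"
proof -
  interpret endo_action G A \<alpha>
    by (intro endo_action.intro endo_action_axioms.intro assms)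
  let ?fin = "{X. X \<subseteq> carrier A \<and> finite X \<and> X \<noteq> {}}" and ?sub = "{X. subgroup X A \<and> finite X}"
  have sub: "X \<subseteq> carrier A \<and> finite X \<and> X \<noteq> {}" if "X \<in> ?sub" for X
    using that subgroup.subset subgroup.one_closed by fastforce
  \<comment> \<open>In the infinite case the suprema of the constant 0 must range over non-empty
    families, since an empty one would give minus infinity.\<close>
  have triv: "{\<one>\<^bsub>A\<^esub>} \<in> ?fin" "{\<one>\<^bsub>A\<^esub>} \<in> ?sub"
    using A.triv_subgroup by auto
  show ?thesis
  proof (cases "finite N")
    case True
    interpret finite_kernel_action G A \<alpha> N
      by (intro finite_kernel_action.intro finite_kernel_action_axioms.intro endo_action_axioms assms True)
    have "h_alg G A \<alpha> = h_alg (G Mod N) A (quotient_action \<alpha>) / ereal (real (card N))"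
      unfolding h_alg_def
      using trajectory_kernel_finite_subset by (intro SUP_H_alg_eq_quotient assms(2)) auto
    moreover have "ent G A \<alpha> = ent (G Mod N) A (quotient_action \<alpha>) / ereal (real (card N))"
      unfolding ent_def
      using sub trajectory_kernel_subgroup by (intro SUP_H_alg_eq_quotient assms(2)) auto
    ultimately show ?thesis
      using True by simp
  next
    case False
    have zero: "H_alg G A \<alpha> X = 0" if "X \<subseteq> carrier A \<and> finite X \<and> X \<noteq> {}" for X
      using H_alg_eq_entropy_rate[OF _ _ _ assms(2)] entropy_rate_infinite_kernel[OF _ _ _ False assms(6)] that
      by simp
    have "h_alg G A \<alpha> = 0"
      unfolding h_alg_def using triv zero by (intro SUP_eq_const) (auto simp: zero_ereal_def)
    moreover have "ent G A \<alpha> = 0"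
      unfolding ent_def
    proof (rule SUP_eq_const)
      show "?sub \<noteq> {}"
        using triv(2) by blast
      show "ereal (H_alg G A \<alpha> X) = 0" if "X \<in> ?sub" for X
        using zero[OF sub[OF that]] by simp
    qed
    ultimately show ?thesis
      using False by simp
  qed
qed

end
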